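(* Let $G$ be a $k\times n$ integer matrix with no zero column, let $\rho_0$ be the lcm period of $G$, let $r$ be the rank of $G$ and let $e_1\mid e_2\mid\cdots\mid e_r$ be the elementary divisors of $G$. Let $m\in\mathbb{Z}_{>0}$ be a divisor of $\rho_0$. For $q\in\mathbb{Z}_{>0}$ let $d_q$ denote the minimum weight of the code $C_G(q)$. Then: (1) Let $m_0:=\min\{q\in\mathbb{Z}\mid q>1,\ \gcd(q,\rho_0)=1\}$. Then for every integer $q>1$ with $\gcd(q,\rho_0)=1$ we have $d_q=d_{m_0}$. (2) If $m\ge 2$ and $\gcd(m,e_r)=1$, then $d_q=d_m$ for every $q\in\mathbb{Z}_{>0}$ with $\gcd(q,\rho_0)=m$. (3) If $d_q=d_m$ for every $q\in\mathbb{Z}_{>0}$ with $\gcd(q,\rho_0)=m$, then $m\nmid e_1$.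
   Context: $\mathbb{Z}_q:=\mathbb{Z}/q\mathbb{Z}$. For $G\in\mathrm{Mat}_{k\times n}(\mathbb{Z})$ with columns $g^1,\dots,g^n$ (all nonzero), $E:=\{1,\dots,n\}$. The code $C_G(q):=\{uG\mid u\in\mathbb{Z}_q^k\}\subseteq\mathbb{Z}_q^n$. For $v\in\mathbb{Z}_q^n$, $\mathrm{supp}(v)=\{i\mid v_i\neq0\}$ and $\mathrm{wt}(v)=|\mathrm{supp}(v)|$. The minimum weight of $C_G(q)$ is $\min\{\mathrm{wt}(c)\mid c\in C_G(q)\setminus\{0\}\}$ if $C_G(q)\ne\{0\}$ and $+\infty$ otherwise (so $d_1=+\infty$). For nonempty $J\subseteq E$, $G_J$ is the submatrix of $G$ consisting of the columns indexed by $J$, $r(J)$ its rank, and $e_{1,J}\mid\cdots\mid e_{r(J),J}$ its elementary divisors (nonzero diagonal entries of its Smith normal form). The lcm period is $\rho_0:=\mathrm{lcm}(e_{r(J),J}\mid \emptyset\ne J\subseteq E)$. The elementary divisors of $G$ are $e_i=e_{i,E}$. *)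

theory Defs
  imports
    "HOL-Number_Theory.Residues"
    "HOL-Library.Extended_Nat"
    "Jordan_Normal_Form.DL_Rank"
    "Jordan_Normal_Form.DL_Submatrix"
begin

text \<open>Rows and columns are indexed from 0, so the column index set \<open>E\<close> is \<open>{..<dim_col G}\<close>.\<close>

definition cols_submatrix :: "int mat \<Rightarrow> nat set \<Rightarrow> int mat" where
  "cols_submatrix G J = submatrix G UNIV J"

definition int_mat_rank :: "int mat \<Rightarrow> nat" where
  "int_mat_rank A = vec_space.rank (dim_row A) (map_mat rat_of_int A)"

definition is_smith_normal_form_of :: "int mat \<Rightarrow> int mat \<Rightarrow> bool" where
  "is_smith_normal_form_of D A \<longleftrightarrow>
     D \<in> carrier_mat (dim_row A) (dim_col A) \<and>
     diagonal_mat D \<and>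
     (\<forall>i < min (dim_row D) (dim_col D). D $$ (i, i) \<ge> 0) \<and>
     (\<forall>i. Suc i < min (dim_row D) (dim_col D) \<longrightarrow> D $$ (i, i) dvd D $$ (Suc i, Suc i)) \<and>
     (\<exists>P Q. P \<in> carrier_mat (dim_row A) (dim_row A) \<and> invertible_mat P \<and>
            Q \<in> carrier_mat (dim_col A) (dim_col A) \<and> invertible_mat Q \<and>
            D = P * A * Q)"

text \<open>Over the integers \<open>invertible_mat\<close> means unimodular. Every integer matrix has exactly one
  Smith normal form in the above sense (the diagonal is normalised to be non-negative), so the
  choice operator picks the Smith normal form.\<close>

definition smith_normal_form :: "int mat \<Rightarrow> int mat" where
  "smith_normal_form A = (SOME D. is_smith_normal_form_of D A)"

definition elementary_divisors :: "int mat \<Rightarrow> int list" where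
  "elementary_divisors A = filter (\<lambda>d. d \<noteq> 0)
     (map (\<lambda>i. smith_normal_form A $$ (i, i)) [0..<min (dim_row A) (dim_col A)])"

text \<open>\<open>elementary_divisor A i\<close> is \<open>e\<^sub>i\<close>, numbered from 1; it is meaningful for
  \<open>1 \<le> i \<le> int_mat_rank A\<close> only.\<close>

definition elementary_divisor :: "int mat \<Rightarrow> nat \<Rightarrow> int" where
  "elementary_divisor A i = elementary_divisors A ! (i - 1)"

definition lcm_period :: "int mat \<Rightarrow> int" where
  "lcm_period G =
     Lcm {elementary_divisor (cols_submatrix G J) (int_mat_rank (cols_submatrix G J)) | J.
            J \<noteq> {} \<and> J \<subseteq> {..<dim_col G}}"

text \<open>For \<open>q > 0\<close>, \<open>\<int>/q\<int>\<close> is represented by \<open>residue_ring q\<close>, whose carrier is \<open>{0..q - 1}\<close>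
  (also for \<open>q = 1\<close>). A word over it is an integer vector with all entries in that carrier.\<close>

definition residue_vecs :: "int \<Rightarrow> nat \<Rightarrow> int vec set" where
  "residue_vecs q k = {u \<in> carrier_vec k. \<forall>i < k. u $ i \<in> carrier (residue_ring q)}"

definition code :: "int mat \<Rightarrow> int \<Rightarrow> int vec set" where
  "code G q = {vec (dim_col G) (\<lambda>j. (u \<bullet> col G j) mod q) | u. u \<in> residue_vecs q (dim_row G)}"

definition supp :: "int vec \<Rightarrow> nat set" where
  "supp v = {i. i < dim_vec v \<and> v $ i \<noteq> 0}"

definition wt :: "int vec \<Rightarrow> nat" where
  "wt v = card (supp v)"

definition min_weight :: "int mat \<Rightarrow> int \<Rightarrow> enat" where
  "min_weight G q =
     (if code G q = {0\<^sub>v (dim_col G)} then \<infinity>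
      else enat (Min (wt ` (code G q - {0\<^sub>v (dim_col G)}))))"

end

theory Submission
  imports Defs "Jordan_Normal_Form.Column_Operations"
begin

text \<open>The left kernel of \<open>G\<^sub>J\<close> modulo \<open>q\<close> is the set of messages \<open>u\<close> whose codeword \<open>uG\<close> vanishes
  on \<open>J\<close>. By the Smith normal form it has \<open>q\<^bsup>k - r(J)\<^esup> \<Prod>\<^sub>i gcd(e\<^bsub>i,J\<^esub>, q)\<close> elements, where
  \<open>gcd(e\<^bsub>i,J\<^esub>, q) = gcd(e\<^bsub>i,J\<^esub>, gcd(q, \<rho>\<^sub>0))\<close>. The minimum weight is determined by the family of
  those \<open>J\<close> whose kernel is strictly larger than that of \<open>G\<close>. If \<open>q > 1\<close> and \<open>gcd(q, \<rho>\<^sub>0)\<close> is coprime to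
  \<open>e\<^sub>r\<close>, then the kernel of \<open>G\<close> has \<open>q\<^bsup>k - r\<^esup>\<close> elements, and comparing the two counts gives a criterion
  in which \<open>q\<close> occurs only through \<open>gcd(q, \<rho>\<^sub>0)\<close>; this yields (1) and (2). If \<open>m\<close> divides \<open>e\<^sub>1\<close>, then \<open>G\<close>
  vanishes modulo \<open>m\<close>, so \<open>d\<^sub>m = \<infinity>\<close>, whereas \<open>d\<^sub>q\<close> is finite for \<open>q = m (1 + \<rho>\<^sub>0 g)\<close> with \<open>g\<close> the
  absolute value of a non-zero entry of \<open>G\<close>.\<close>

section \<open>Unimodular equivalence and the Smith normal form\<close>

text \<open>\<open>invertible_mat\<close> does not state the size of the inverse; comparing the
  dimensions of both products with those of the identity matrices forces it.\<close>

lemma invertible_matE: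
  fixes P :: "'a :: semiring_1 mat"
  assumes "invertible_mat P" and P: "P \<in> carrier_mat n n"
  obtains P' where "P' \<in> carrier_mat n n" "P * P' = 1\<^sub>m n" "P' * P = 1\<^sub>m n"
proof -
  obtain P' where a: "P * P' = 1\<^sub>m n" and b: "P' * P = 1\<^sub>m (dim_row P')"
    using assms unfolding invertible_mat_def inverts_mat_def by auto
  have c: "dim_col P' = n" using arg_cong[OF a, of dim_col] by simp
  have r: "dim_row P' = n" using arg_cong[OF b, of dim_col] P by simp
  show ?thesis using that[OF carrier_matI[OF r c] a b[unfolded r]] .
qed

lemma invertible_matI:
  fixes P :: "'a :: semiring_1 mat"
  assumes "P \<in> carrier_mat n n" "P' \<in> carrier_mat n n" "P * P' = 1\<^sub>m n" "P' * P = 1\<^sub>m n"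
  shows "invertible_mat P"
  using assms unfolding invertible_mat_def inverts_mat_def by auto

lemma invertible_mat_one: "invertible_mat (1\<^sub>m n :: 'a :: semiring_1 mat)"
  by (rule invertible_matI[of _ n "1\<^sub>m n"]) auto

lemma mult_four_factors:
  fixes A :: "'a :: semiring_1 mat"
  assumes "A \<in> carrier_mat n a" "B \<in> carrier_mat a b" "C \<in> carrier_mat b c" "D \<in> carrier_mat c d"
  shows "(A * B) * (C * D) = A * ((B * C) * D)"
  using assms by (simp add: assoc_mult_mat[of _ n a _ b _ d] assoc_mult_mat[of _ a b _ c _ d])

lemma invertible_mat_mult:
  fixes P :: "'a :: semiring_1 mat"
  assumes P: "P \<in> carrier_mat n n" "invertible_mat P" and R: "R \<in> carrier_mat n n" "invertible_mat R"
  shows "invertible_mat (P * R)"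
proof -
  obtain P' where P': "P' \<in> carrier_mat n n" "P * P' = 1\<^sub>m n" "P' * P = 1\<^sub>m n"
    using invertible_matE[OF P(2,1)] by blast
  obtain R' where R': "R' \<in> carrier_mat n n" "R * R' = 1\<^sub>m n" "R' * R = 1\<^sub>m n"
    using invertible_matE[OF R(2,1)] by blast
  show ?thesis
    by (rule invertible_matI[of _ n "R' * P'"])
       (use P R P' R' in \<open>auto simp: mult_four_factors[of _ n n _ n _ n _ n]\<close>)
qed

lemma invertible_swaprows_mat:
  "k < n \<Longrightarrow> l < n \<Longrightarrow> invertible_mat (swaprows_mat n k l :: 'a :: comm_ring_1 mat)"
  by (rule invertible_matI[of _ n "swaprows_mat n k l"]) (auto simp: swaprows_mat_inv)

lemma invertible_addrow_mat:
  "k < n \<Longrightarrow> l < n \<Longrightarrow> k \<noteq> l \<Longrightarrow> invertible_mat (addrow_mat n (a :: 'a :: comm_ring_1) k l)"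
  using addrow_mat_inv[of k n l "- a"]
  by (intro invertible_matI[OF addrow_mat_carrier addrow_mat_carrier addrow_mat_inv]) simp_all

lemma uminus_r_inv_mat:
  "A \<in> carrier_mat nr nc \<Longrightarrow> (A :: 'a :: group_add mat) + - A = 0\<^sub>m nr nc"
  by (rule eq_matI) auto

text \<open>Two such matrices multiply by adding their lower left blocks, so negating
  \<open>C\<close> inverts. For \<open>n1 = 1\<close>, multiplication from the left adds multiples
  of the first row to all other rows at once.\<close>

lemma invertible_four_block_lower:
  fixes C :: "'a :: comm_ring_1 mat"
  assumes "C \<in> carrier_mat n2 n1"
  shows "invertible_mat (four_block_mat (1\<^sub>m n1) (0\<^sub>m n1 n2) C (1\<^sub>m n2))"
proof (rule invertible_matI[of _ "n1 + n2" "four_block_mat (1\<^sub>m n1) (0\<^sub>m n1 n2) (- C) (1\<^sub>m n2)"])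
  have *: "four_block_mat (1\<^sub>m n1) (0\<^sub>m n1 n2) X (1\<^sub>m n2) * four_block_mat (1\<^sub>m n1) (0\<^sub>m n1 n2) Y (1\<^sub>m n2)
      = 1\<^sub>m (n1 + n2)" if "X \<in> carrier_mat n2 n1" "Y \<in> carrier_mat n2 n1" "X + Y = 0\<^sub>m n2 n1" for X Y :: "'a mat"
    using that by (subst mult_four_block_mat[of _ n1 n1 _ n2 _ n2 _ _ n1 _ n2]) auto
  show "four_block_mat (1\<^sub>m n1) (0\<^sub>m n1 n2) C (1\<^sub>m n2) * four_block_mat (1\<^sub>m n1) (0\<^sub>m n1 n2) (- C) (1\<^sub>m n2)
      = 1\<^sub>m (n1 + n2)"
    "four_block_mat (1\<^sub>m n1) (0\<^sub>m n1 n2) (- C) (1\<^sub>m n2) * four_block_mat (1\<^sub>m n1) (0\<^sub>m n1 n2) C (1\<^sub>m n2)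
      = 1\<^sub>m (n1 + n2)"
    using assms by (auto intro!: * simp: uminus_r_inv_mat[of _ n2 n1])
qed (use assms in auto)

text \<open>The mirror image for columns: for \<open>n1 = 1\<close>, multiplication from the right
  adds multiples of the first column to all others at once.\<close>

lemma invertible_four_block_upper:
  fixes B :: "'a :: comm_ring_1 mat"
  assumes "B \<in> carrier_mat n1 n2"
  shows "invertible_mat (four_block_mat (1\<^sub>m n1) B (0\<^sub>m n2 n1) (1\<^sub>m n2))"
proof (rule invertible_matI[of _ "n1 + n2" "four_block_mat (1\<^sub>m n1) (- B) (0\<^sub>m n2 n1) (1\<^sub>m n2)"])
  have *: "four_block_mat (1\<^sub>m n1) X (0\<^sub>m n2 n1) (1\<^sub>m n2) * four_block_mat (1\<^sub>m n1) Y (0\<^sub>m n2 n1) (1\<^sub>m n2)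
      = 1\<^sub>m (n1 + n2)" if "X \<in> carrier_mat n1 n2" "Y \<in> carrier_mat n1 n2" "Y + X = 0\<^sub>m n1 n2" for X Y :: "'a mat"
    using that by (subst mult_four_block_mat[of _ n1 n1 _ n2 _ n2 _ _ n1 _ n2]) auto
  show "four_block_mat (1\<^sub>m n1) B (0\<^sub>m n2 n1) (1\<^sub>m n2) * four_block_mat (1\<^sub>m n1) (- B) (0\<^sub>m n2 n1) (1\<^sub>m n2)
      = 1\<^sub>m (n1 + n2)"
    "four_block_mat (1\<^sub>m n1) (- B) (0\<^sub>m n2 n1) (1\<^sub>m n2) * four_block_mat (1\<^sub>m n1) B (0\<^sub>m n2 n1) (1\<^sub>m n2)
      = 1\<^sub>m (n1 + n2)"
    using assms by (auto intro!: * simp: uminus_r_inv_mat[of _ n1 n2])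
qed (use assms in auto)

lemma invertible_four_block_diag:
  fixes P :: "'a :: comm_ring_1 mat"
  assumes P: "P \<in> carrier_mat n1 n1" "invertible_mat P" and R: "R \<in> carrier_mat n2 n2" "invertible_mat R"
  shows "invertible_mat (four_block_mat P (0\<^sub>m n1 n2) (0\<^sub>m n2 n1) R)"
proof -
  obtain P' where P': "P' \<in> carrier_mat n1 n1" "P * P' = 1\<^sub>m n1" "P' * P = 1\<^sub>m n1"
    using invertible_matE[OF P(2,1)] by blast
  obtain R' where R': "R' \<in> carrier_mat n2 n2" "R * R' = 1\<^sub>m n2" "R' * R = 1\<^sub>m n2"
    using invertible_matE[OF R(2,1)] by blast
  show ?thesis
    by (rule invertible_matI[of _ "n1 + n2" "four_block_mat P' (0\<^sub>m n1 n2) (0\<^sub>m n2 n1) R'"])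
       (use P R P' R' in \<open>auto simp: mult_four_block_mat[of _ n1 n1 _ n2 _ n2 _ _ n1 _ n2]\<close>)
qed

section \<open>Unimodular equivalence and elementary operations\<close>

definition unimod_equiv :: "int mat \<Rightarrow> int mat \<Rightarrow> bool" where
  "unimod_equiv A B \<longleftrightarrow> (\<exists>P Q. P \<in> carrier_mat (dim_row A) (dim_row A) \<and> invertible_mat P \<and>
     Q \<in> carrier_mat (dim_col A) (dim_col A) \<and> invertible_mat Q \<and> B = P * A * Q)"

lemma unimod_equivI:
  assumes "A \<in> carrier_mat nr nc" "P \<in> carrier_mat nr nr" "invertible_mat P"
    "Q \<in> carrier_mat nc nc" "invertible_mat Q" "B = P * A * Q"
  shows "unimod_equiv A B"
  using assms(2-) unfolding unimod_equiv_def carrier_matD[OF assms(1)] by blast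

lemma unimod_equivE:
  assumes "unimod_equiv A B" "A \<in> carrier_mat nr nc"
  obtains P P' Q Q' where "P \<in> carrier_mat nr nr" "P' \<in> carrier_mat nr nr" "P * P' = 1\<^sub>m nr" "P' * P = 1\<^sub>m nr"
    "Q \<in> carrier_mat nc nc" "Q' \<in> carrier_mat nc nc" "Q * Q' = 1\<^sub>m nc" "Q' * Q = 1\<^sub>m nc" "B = P * A * Q"
proof -
  obtain P Q where PQ: "P \<in> carrier_mat nr nr" "invertible_mat P"
    "Q \<in> carrier_mat nc nc" "invertible_mat Q" "B = P * A * Q"
    using assms unfolding unimod_equiv_def by auto
  obtain P' where "P' \<in> carrier_mat nr nr" "P * P' = 1\<^sub>m nr" "P' * P = 1\<^sub>m nr"
    using invertible_matE[OF PQ(2,1)] by blast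
  moreover obtain Q' where "Q' \<in> carrier_mat nc nc" "Q * Q' = 1\<^sub>m nc" "Q' * Q = 1\<^sub>m nc"
    using invertible_matE[OF PQ(4,3)] by blast
  ultimately show ?thesis using that PQ by blast
qed

lemma unimod_equiv_carrier:
  "unimod_equiv A B \<Longrightarrow> A \<in> carrier_mat nr nc \<Longrightarrow> B \<in> carrier_mat nr nc"
  unfolding unimod_equiv_def by auto

lemma unimod_equiv_refl: "unimod_equiv A A"
  by (rule unimod_equivI[of A "dim_row A" "dim_col A" "1\<^sub>m (dim_row A)" "1\<^sub>m (dim_col A)"])
     (auto simp: invertible_mat_one)

lemma unimod_equiv_sym:
  assumes AB: "unimod_equiv A B"
  shows "unimod_equiv B A"
proof -
  define nr nc where "nr = dim_row A" and "nc = dim_col A"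
  have A: "A \<in> carrier_mat nr nc" by (simp add: nr_def nc_def)
  obtain P P' Q Q' where PQ: "P \<in> carrier_mat nr nr" "P' \<in> carrier_mat nr nr" "P * P' = 1\<^sub>m nr" "P' * P = 1\<^sub>m nr"
    "Q \<in> carrier_mat nc nc" "Q' \<in> carrier_mat nc nc" "Q * Q' = 1\<^sub>m nc" "Q' * Q = 1\<^sub>m nc" "B = P * A * Q"
    using unimod_equivE[OF AB A] by blast
  have "P' * B * Q' = (P' * P) * A * (Q * Q')"
    unfolding PQ(9) using A PQ(1,2,5,6)
    by (simp add: assoc_mult_mat[of _ nr nr _ nr _ nc] assoc_mult_mat[of _ nr nr _ nc _ nc]
      assoc_mult_mat[of _ nr nc _ nc _ nc])
  then have "A = P' * B * Q'" using PQ A by simp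
  then show ?thesis
    by (intro unimod_equivI[OF unimod_equiv_carrier[OF AB A] PQ(2) invertible_matI[OF PQ(2,1,4,3)]
      PQ(6) invertible_matI[OF PQ(6,5,8,7)]])
qed

lemma unimod_equiv_trans:
  assumes AB: "unimod_equiv A B" and BC: "unimod_equiv B C"
  shows "unimod_equiv A C"
proof -
  define nr nc where "nr = dim_row A" and "nc = dim_col A"
  have A: "A \<in> carrier_mat nr nc" by (simp add: nr_def nc_def)
  have B: "B \<in> carrier_mat nr nc" using unimod_equiv_carrier[OF AB A] .
  obtain P Q where PQ: "P \<in> carrier_mat nr nr" "invertible_mat P"
    "Q \<in> carrier_mat nc nc" "invertible_mat Q" "B = P * A * Q"
    using AB A unfolding unimod_equiv_def by auto
  obtain R S where RS: "R \<in> carrier_mat nr nr" "invertible_mat R"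
    "S \<in> carrier_mat nc nc" "invertible_mat S" "C = R * B * S"
    using BC B unfolding unimod_equiv_def by auto
  have "C = (R * P) * A * (Q * S)"
    unfolding RS(5) PQ(5) using A PQ(1,3) RS(1,3)
    by (simp add: assoc_mult_mat[of _ nr nr _ nr _ nc] assoc_mult_mat[of _ nr nr _ nc _ nc]
      assoc_mult_mat[of _ nr nc _ nc _ nc])
  then show ?thesis
    by (intro unimod_equivI[OF A _ invertible_mat_mult[OF RS(1,2) PQ(1,2)] _
        invertible_mat_mult[OF PQ(3,4) RS(3,4)]] mult_carrier_mat[OF RS(1) PQ(1)]
        mult_carrier_mat[OF PQ(3) RS(3)])
qed

lemma unimod_equiv_rowI:
  assumes "A \<in> carrier_mat nr nc" "P \<in> carrier_mat nr nr" "invertible_mat P" "B = P * A"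
  shows "unimod_equiv A B"
  by (rule unimod_equivI[OF assms(1-3), of "1\<^sub>m nc"]) (use assms in \<open>auto simp: invertible_mat_one\<close>)

lemma unimod_equiv_colI:
  assumes "A \<in> carrier_mat nr nc" "Q \<in> carrier_mat nc nc" "invertible_mat Q" "B = A * Q"
  shows "unimod_equiv A B"
  by (rule unimod_equivI[OF assms(1) _ _ assms(2,3), of "1\<^sub>m nr"]) (use assms in \<open>auto simp: invertible_mat_one\<close>)

lemma unimod_equiv_swaprows:
  "A \<in> carrier_mat nr nc \<Longrightarrow> k < nr \<Longrightarrow> l < nr \<Longrightarrow> unimod_equiv A (swaprows k l A)"
  by (rule unimod_equiv_rowI[of _ nr nc "swaprows_mat nr k l"]) (auto simp: invertible_swaprows_mat swaprows_mat)

lemma unimod_equiv_addrow: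
  "A \<in> carrier_mat nr nc \<Longrightarrow> k < nr \<Longrightarrow> l < nr \<Longrightarrow> k \<noteq> l \<Longrightarrow> unimod_equiv A (addrow a k l A)"
  by (rule unimod_equiv_rowI[of _ nr nc "addrow_mat nr a k l"]) (auto simp: invertible_addrow_mat addrow_mat)

lemma unimod_equiv_swapcols:
  "A \<in> carrier_mat nr nc \<Longrightarrow> k < nc \<Longrightarrow> l < nc \<Longrightarrow> unimod_equiv A (swapcols k l A)"
  by (rule unimod_equiv_colI[of _ nr nc "swaprows_mat nc k l"]) (auto simp: invertible_swaprows_mat swapcols_mat)

lemma unimod_equiv_addcol:
  "A \<in> carrier_mat nr nc \<Longrightarrow> k < nc \<Longrightarrow> l < nc \<Longrightarrow> k \<noteq> l \<Longrightarrow> unimod_equiv A (addcol a k l A)"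
  by (rule unimod_equiv_colI[of _ nr nc "addrow_mat nc a l k"]) (auto simp: invertible_addrow_mat addcol_mat)

lemma unimod_equiv_uminus: "unimod_equiv A (- A)"
  by (rule unimod_equiv_rowI[of A "dim_row A" "dim_col A" "- 1\<^sub>m (dim_row A)"])
     (auto intro!: invertible_matI[of _ "dim_row A" "- 1\<^sub>m (dim_row A)"])

section \<open>Common divisors of the entries and reduction to block form\<close>

lemma dvd_mult_mat_left:
  fixes A :: "'a :: comm_semiring_1 mat"
  assumes "A \<in> carrier_mat n m" "B \<in> carrier_mat m l" "\<forall>i<m. \<forall>j<l. x dvd B $$ (i,j)" "i < n" "j < l"
  shows "x dvd (A * B) $$ (i,j)"
  using assms by (auto simp: scalar_prod_def intro!: dvd_sum dvd_mult)

lemma dvd_mult_mat_right: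
  fixes A :: "'a :: comm_semiring_1 mat"
  assumes "A \<in> carrier_mat n m" "B \<in> carrier_mat m l" "\<forall>i<n. \<forall>j<m. x dvd A $$ (i,j)" "i < n" "j < l"
  shows "x dvd (A * B) $$ (i,j)"
  using assms by (auto simp: scalar_prod_def intro!: dvd_sum dvd_mult2)

text \<open>Every entry of \<open>P * A * Q\<close> is an integral combination of the entries of
  \<open>A\<close>.\<close>

lemma unimod_equiv_dvd:
  assumes AB: "unimod_equiv A B" and A: "A \<in> carrier_mat nr nc"
    and dvd: "\<forall>i<nr. \<forall>j<nc. x dvd A $$ (i,j)" and "i < nr" "j < nc"
  shows "x dvd B $$ (i,j)"
proof -
  obtain P Q where PQ: "P \<in> carrier_mat nr nr" "Q \<in> carrier_mat nc nc" "B = P * A * Q"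
    using AB A unfolding unimod_equiv_def by auto
  have "\<forall>i<nr. \<forall>j<nc. x dvd (P * A) $$ (i,j)"
    using dvd_mult_mat_left[OF PQ(1) A dvd] by blast
  then show ?thesis
    unfolding PQ(3) using dvd_mult_mat_right[of "P * A" nr nc Q nc x i j] PQ A assms(4,5) by auto
qed

text \<open>Every entry can be moved to the upper left corner, so a smallest positive value there is a
  lower bound for all non-zero entries of all equivalent matrices.\<close>

lemma unimod_equiv_corner:
  assumes A: "A \<in> carrier_mat nr nc" and ij: "i < nr" "j < nc"
  shows "\<exists>B. unimod_equiv A B \<and> B $$ (0,0) = \<bar>A $$ (i,j)\<bar>"
proof -
  have nr: "0 < nr" and nc: "0 < nc" using ij by auto
  define B where "B = swapcols 0 j (swaprows 0 i A)"
  have AB: "unimod_equiv A B" unfolding B_def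
    using unimod_equiv_trans[OF unimod_equiv_swaprows[OF A nr ij(1)] unimod_equiv_swapcols[OF _ nc ij(2), of _ nr]] A
    by simp
  have B00: "B $$ (0,0) = A $$ (i,j)" unfolding B_def using A nr nc ij by auto
  show ?thesis
  proof (cases "A $$ (i,j) \<ge> 0")
    case True then show ?thesis using AB B00 by auto
  next
    case False
    have "(- B) $$ (0,0) = \<bar>A $$ (i,j)\<bar>"
      using False B00 unimod_equiv_carrier[OF AB A] nr nc by auto
    then show ?thesis using unimod_equiv_trans[OF AB unimod_equiv_uminus] by blast
  qed
qed

text \<open>One round of Smith reduction, by minimality instead of a Euclidean algorithm: a smallest
  positive corner value \<open>g\<close> divides its row and column because remainders are too
  small, and clearing both leaves the block \<open>A'\<close>.\<close>

lemma unimod_equiv_block: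
  assumes A: "A \<in> carrier_mat (Suc nr) (Suc nc)" and nz: "A \<noteq> 0\<^sub>m (Suc nr) (Suc nc)"
  obtains g A' where "g > 0" "A' \<in> carrier_mat nr nc" "\<forall>i<nr. \<forall>j<nc. g dvd A' $$ (i,j)"
    "unimod_equiv A (four_block_mat (g \<cdot>\<^sub>m 1\<^sub>m 1) (0\<^sub>m 1 nc) (0\<^sub>m nr 1) A')"
proof -
  let ?S = "\<lambda>B. unimod_equiv A B \<and> B $$ (0,0) > 0"
  have "\<exists>i<Suc nr. \<exists>j<Suc nc. A $$ (i,j) \<noteq> 0"
  proof (rule ccontr)
    assume "\<not> ?thesis"
    then have "A = 0\<^sub>m (Suc nr) (Suc nc)" using A by (intro eq_matI) auto
    then show False using nz by simp
  qed
  then obtain i j where ij: "i < Suc nr" "j < Suc nc" "A $$ (i,j) \<noteq> 0" by blast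
  obtain B1 where "unimod_equiv A B1" "B1 $$ (0,0) = \<bar>A $$ (i,j)\<bar>"
    using unimod_equiv_corner[OF A ij(1,2)] by blast
  then have "?S B1" using ij(3) by simp
  then obtain B where AB: "unimod_equiv A B" and B0: "B $$ (0,0) > 0"
    and least: "\<And>C. ?S C \<Longrightarrow> nat (B $$ (0,0)) \<le> nat (C $$ (0,0))"
    using ex_has_least_nat[of ?S _ "\<lambda>B. nat (B $$ (0,0))"] by blast
  define g where "g = B $$ (0,0)"
  have g: "g > 0" using B0 by (simp add: g_def)
  \<comment> \<open>A non-zero entry of any equivalent matrix can be moved to the corner up to sign,
    so it cannot undercut the minimum \<open>g\<close>.\<close>
  have lower: "C $$ (i,j) = 0 \<or> g \<le> \<bar>C $$ (i,j)\<bar>"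
    if AC: "unimod_equiv A C" and ij: "i < Suc nr" "j < Suc nc" for C i j
  proof -
    obtain C' where "unimod_equiv C C'" "C' $$ (0,0) = \<bar>C $$ (i,j)\<bar>"
      using unimod_equiv_corner[OF unimod_equiv_carrier[OF AC A] ij] by blast
    then show ?thesis using least[of C'] unimod_equiv_trans[OF AC, of C'] g_def B0 by fastforce
  qed
  have mod_small: "x mod g = 0 \<or> \<not> g \<le> \<bar>x mod g\<bar>" for x
    using pos_mod_bound[OF g, of x] pos_mod_sign[OF g, of x] by linarith
  \<comment> \<open>A column operation replaces the entry by its remainder modulo \<open>g\<close>,
    which \<open>lower\<close> forces to be 0.\<close>
  have row: "g dvd C $$ (0,j)"
    if AC: "unimod_equiv A C" and C0: "C $$ (0,0) = g" and j: "j < Suc nc" for C j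
  proof (cases "j = 0")
    case False
    have C: "C \<in> carrier_mat (Suc nr) (Suc nc)" using unimod_equiv_carrier[OF AC A] .
    define C' where "C' = addcol (- (C $$ (0,j) div g)) j 0 C"
    have "unimod_equiv A C'" unfolding C'_def
      using unimod_equiv_trans[OF AC unimod_equiv_addcol[OF C j _ False]] by simp
    moreover have "C' $$ (0,j) = C $$ (0,j) mod g"
      unfolding C'_def using C j C0 False by (simp add: minus_div_mult_eq_mod[symmetric])
    ultimately show ?thesis using lower[of C' 0 j] j mod_small by (auto simp: dvd_eq_mod_eq_0)
  qed (use C0 in simp)
  have col: "g dvd C $$ (i,0)"
    if AC: "unimod_equiv A C" and C0: "C $$ (0,0) = g" and i: "i < Suc nr" for C i
  proof (cases "i = 0")
    case False
    have C: "C \<in> carrier_mat (Suc nr) (Suc nc)" using unimod_equiv_carrier[OF AC A] .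
    define C' where "C' = addrow (- (C $$ (i,0) div g)) i 0 C"
    have "unimod_equiv A C'" unfolding C'_def
      using unimod_equiv_trans[OF AC unimod_equiv_addrow[OF C i _ False]] by simp
    moreover have "C' $$ (i,0) = C $$ (i,0) mod g"
      unfolding C'_def using C i C0 False by (simp add: minus_div_mult_eq_mod[symmetric])
    ultimately show ?thesis using lower[of C' i 0] i mod_small by (auto simp: dvd_eq_mod_eq_0)
  qed (use C0 in simp)
  have B: "B \<in> carrier_mat (Suc nr) (Suc nc)" using unimod_equiv_carrier[OF AB A] .
  \<comment> \<open>\<open>R\<close> and \<open>L\<close> hold the negated quotients by
    \<open>g\<close>, so the first row and column of \<open>B\<close> beyond the corner are
    \<open>- (g \<cdot>\<^sub>m R)\<close> and \<open>- (g \<cdot>\<^sub>m L)\<close>.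
    \<open>A'\<close> is what the lower right block \<open>X\<close> becomes once these are
    cleared.\<close>
  define R where "R = mat 1 nc (\<lambda>(i,j). - (B $$ (0, Suc j) div g))"
  define L where "L = mat nr 1 (\<lambda>(i,j). - (B $$ (Suc i, 0) div g))"
  define X where "X = mat nr nc (\<lambda>(i,j). B $$ (Suc i, Suc j))"
  define A' where "A' = L * (- (g \<cdot>\<^sub>m R)) + X"
  have RLX: "R \<in> carrier_mat 1 nc" "L \<in> carrier_mat nr 1" "X \<in> carrier_mat nr nc"
    by (auto simp: R_def L_def X_def)
  have A': "A' \<in> carrier_mat nr nc" using RLX by (simp add: A'_def)
  have Bblock: "B = four_block_mat (g \<cdot>\<^sub>m 1\<^sub>m 1) (- (g \<cdot>\<^sub>m R)) (- (g \<cdot>\<^sub>m L)) X"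
  proof (rule eq_matI)
    fix i j assume "i < dim_row (four_block_mat (g \<cdot>\<^sub>m 1\<^sub>m 1) (- (g \<cdot>\<^sub>m R)) (- (g \<cdot>\<^sub>m L)) X)"
      and "j < dim_col (four_block_mat (g \<cdot>\<^sub>m 1\<^sub>m 1) (- (g \<cdot>\<^sub>m R)) (- (g \<cdot>\<^sub>m L)) X)"
    then have ij: "i < Suc nr" "j < Suc nc" using RLX by auto
    show "B $$ (i,j) = four_block_mat (g \<cdot>\<^sub>m 1\<^sub>m 1) (- (g \<cdot>\<^sub>m R)) (- (g \<cdot>\<^sub>m L)) X $$ (i,j)"
      using ij row[OF AB g_def[symmetric], of j] col[OF AB g_def[symmetric], of i]
      by (cases i; cases j) (auto simp: R_def L_def X_def g_def)
  qed (use B RLX in auto)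
  define C where "C = four_block_mat (g \<cdot>\<^sub>m 1\<^sub>m 1) (0\<^sub>m 1 nc) (0\<^sub>m nr 1) A'"
  let ?L = "four_block_mat (1\<^sub>m 1) (0\<^sub>m 1 nr) L (1\<^sub>m nr)"
  let ?R = "four_block_mat (1\<^sub>m 1) R (0\<^sub>m nc 1) (1\<^sub>m nc)"
  have gm: "g \<cdot>\<^sub>m 1\<^sub>m 1 \<in> carrier_mat 1 1" by simp
  have mR: "(g \<cdot>\<^sub>m 1\<^sub>m 1) * R = g \<cdot>\<^sub>m R"
    using mult_smult_assoc_mat[OF one_carrier_mat RLX(1)] RLX by simp
  have mL: "L * (g \<cdot>\<^sub>m 1\<^sub>m 1) = g \<cdot>\<^sub>m L"
    using mult_smult_distrib[OF RLX(2) one_carrier_mat] RLX by simp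
  have "(g \<cdot>\<^sub>m 1\<^sub>m 1) * 1\<^sub>m 1 + (- (g \<cdot>\<^sub>m R)) * 0\<^sub>m nc 1 = g \<cdot>\<^sub>m 1\<^sub>m 1"
    "(g \<cdot>\<^sub>m 1\<^sub>m 1) * R + (- (g \<cdot>\<^sub>m R)) * 1\<^sub>m nc = 0\<^sub>m 1 nc"
    "0\<^sub>m nr 1 * 1\<^sub>m 1 + A' * 0\<^sub>m nc 1 = 0\<^sub>m nr 1"
    "0\<^sub>m nr 1 * R + A' * 1\<^sub>m nc = A'"
    unfolding mR using RLX gm A' by (auto simp: uminus_r_inv_mat[of _ "Suc 0" nc])
  note right = this
  have "1\<^sub>m 1 * (g \<cdot>\<^sub>m 1\<^sub>m 1) + 0\<^sub>m 1 nr * (- (g \<cdot>\<^sub>m L)) = g \<cdot>\<^sub>m 1\<^sub>m 1"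
    "1\<^sub>m 1 * (- (g \<cdot>\<^sub>m R)) + 0\<^sub>m 1 nr * X = - (g \<cdot>\<^sub>m R)"
    "L * (g \<cdot>\<^sub>m 1\<^sub>m 1) + 1\<^sub>m nr * (- (g \<cdot>\<^sub>m L)) = 0\<^sub>m nr 1"
    "L * (- (g \<cdot>\<^sub>m R)) + 1\<^sub>m nr * X = A'"
    unfolding mL A'_def using RLX gm by (auto simp: uminus_r_inv_mat[of _ nr "Suc 0"])
  note left = this
  have "- (g \<cdot>\<^sub>m R) \<in> carrier_mat 1 nc" "- (g \<cdot>\<^sub>m L) \<in> carrier_mat nr 1"
    using RLX by auto
  note RL = this
  have "?L * B = four_block_mat (g \<cdot>\<^sub>m 1\<^sub>m 1) (- (g \<cdot>\<^sub>m R)) (0\<^sub>m nr 1) A'"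
    unfolding Bblock
    by (rule mult_four_block_mat[OF one_carrier_mat zero_carrier_mat RLX(2) one_carrier_mat gm RL RLX(3),
          unfolded left])
  then have "?L * B * ?R = C" unfolding C_def
    by (simp only: mult_four_block_mat[OF gm RL(1) zero_carrier_mat A' one_carrier_mat RLX(1)
          zero_carrier_mat one_carrier_mat, unfolded right])
  then have "unimod_equiv B C"
    using RLX  invertible_four_block_lower[OF RLX(2)] invertible_four_block_upper[OF RLX(1)]
    by (intro unimod_equivI[OF B, of ?L ?R]) auto
  then have AC: "unimod_equiv A C" using unimod_equiv_trans[OF AB] by blast
  have "g dvd A' $$ (i,j)" if ij: "i < nr" "j < nc" for i j
  proof -
    have C: "C \<in> carrier_mat (Suc nr) (Suc nc)" using unimod_equiv_carrier[OF AC A] .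
    \<comment> \<open>The first column of \<open>C\<close> is 0 below the corner, so adding a lower
      row to row 0 keeps \<open>g\<close> there and brings an entry of \<open>A'\<close> into the
      first row, where \<open>row\<close> applies.\<close>
    define C' where "C' = addrow 1 0 (Suc i) C"
    have "unimod_equiv A C'"
      unfolding C'_def using unimod_equiv_trans[OF AC unimod_equiv_addrow[OF C, of 0 "Suc i"]] ij by auto
    moreover have "C' $$ (0,0) = g" "C' $$ (0, Suc j) = A' $$ (i,j)"
      unfolding C'_def using ij A' C by (auto simp: C_def)
    ultimately show ?thesis using row[of C' "Suc j"] ij by auto
  qed
  then show ?thesis using that[OF g A'] AC unfolding C_def by blast
qed

section \<open>Existence of the Smith normal form\<close>

lemma is_smith_normal_form_of_iff:
  "is_smith_normal_form_of D A \<longleftrightarrow> unimod_equiv A D \<and> diagonal_mat D \<and>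
     (\<forall>i < min (dim_row A) (dim_col A). D $$ (i, i) \<ge> 0) \<and>
     (\<forall>i. Suc i < min (dim_row A) (dim_col A) \<longrightarrow> D $$ (i, i) dvd D $$ (Suc i, Suc i))"
proof -
  have "D \<in> carrier_mat (dim_row A) (dim_col A)" if "unimod_equiv A D"
    using unimod_equiv_carrier[OF that] by simp
  then show ?thesis
    unfolding is_smith_normal_form_of_def unimod_equiv_def[symmetric] by auto
qed

text \<open>Induction on the number of rows: split off \<open>g\<close> and diagonalise the
  remaining block. A zero matrix, or one without rows or columns, is its own normal form.\<close>

lemma smith_normal_form_exists:
  assumes "A \<in> carrier_mat nr nc"
  shows "\<exists>D. is_smith_normal_form_of D A"
  using assms
proof (induction nr arbitrary: nc A)
  case 0
  then show ?case
    by (intro exI[of _ A]) (auto simp: is_smith_normal_form_of_iff unimod_equiv_refl diagonal_mat_def)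
next
  case (Suc nr)
  show ?case
  proof (cases "nc = 0 \<or> A = 0\<^sub>m (Suc nr) nc")
    case True
    then show ?thesis using Suc.prems
      by (intro exI[of _ A]) (auto simp: is_smith_normal_form_of_iff unimod_equiv_refl diagonal_mat_def)
  next
    case False
    then obtain nc' where nc: "nc = Suc nc'" by (cases nc) auto
    obtain g A' where g: "g > 0" and A': "A' \<in> carrier_mat nr nc'"
      and dvd: "\<forall>i<nr. \<forall>j<nc'. g dvd A' $$ (i,j)"
      and eq: "unimod_equiv A (four_block_mat (g \<cdot>\<^sub>m 1\<^sub>m 1) (0\<^sub>m 1 nc') (0\<^sub>m nr 1) A')"
      using unimod_equiv_block[of A nr nc'] Suc.prems False nc by blast
    obtain D' where D': "is_smith_normal_form_of D' A'" using Suc.IH[OF A'] by blast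
    then have eq': "unimod_equiv A' D'" by (simp add: is_smith_normal_form_of_iff)
    have cD': "D' \<in> carrier_mat nr nc'" using unimod_equiv_carrier[OF eq' A'] .
    obtain P Q where PQ: "P \<in> carrier_mat nr nr" "invertible_mat P"
      "Q \<in> carrier_mat nc' nc'" "invertible_mat Q" "D' = P * A' * Q"
      using eq' A' unfolding unimod_equiv_def by auto
    let ?A = "four_block_mat (g \<cdot>\<^sub>m 1\<^sub>m 1) (0\<^sub>m 1 nc') (0\<^sub>m nr 1) A'"
    let ?P = "four_block_mat (1\<^sub>m 1) (0\<^sub>m 1 nr) (0\<^sub>m nr 1) P"
    let ?Q = "four_block_mat (1\<^sub>m 1) (0\<^sub>m 1 nc') (0\<^sub>m nc' 1) Q"
    define D where "D = four_block_mat (g \<cdot>\<^sub>m 1\<^sub>m 1) (0\<^sub>m 1 nc') (0\<^sub>m nr 1) D'"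
    have "?P * ?A = four_block_mat (g \<cdot>\<^sub>m 1\<^sub>m 1) (0\<^sub>m 1 nc') (0\<^sub>m nr 1) (P * A')"
      using PQ A' by (subst mult_four_block_mat[of _ 1 1 _ nr _ nr _ _ 1 _ nc']) auto
    then have "D = ?P * ?A * ?Q" unfolding D_def PQ(5)
      using PQ A' by (simp, subst mult_four_block_mat[of _ 1 1 _ nc' _ nr _ _ 1 _ nc']) auto
    then have "unimod_equiv ?A D"
      using PQ A' invertible_four_block_diag[of "1\<^sub>m 1" 1, OF _ invertible_mat_one]
      by (intro unimod_equivI[of ?A "1 + nr" "1 + nc'" ?P ?Q]) auto
    then have "unimod_equiv A D" using unimod_equiv_trans[OF eq] by blast
    moreover have "diagonal_mat D"
      using D' cD' unfolding D_def is_smith_normal_form_of_iff diagonal_mat_def by auto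
    moreover have "D $$ (i,i) \<ge> 0" if "i < min (Suc nr) (Suc nc')" for i
      using D' that cD' A' g unfolding D_def is_smith_normal_form_of_iff by (cases i) auto
    \<comment> \<open>For \<open>i = 0\<close> this says that \<open>g\<close> divides the first
      entry of \<open>D'\<close>: it divides all of \<open>A'\<close>, and common divisors survive
      unimodular equivalence.\<close>
    moreover have "D $$ (i,i) dvd D $$ (Suc i, Suc i)" if "Suc i < min (Suc nr) (Suc nc')" for i
      using D' that cD' A' g unimod_equiv_dvd[OF eq' A' dvd, of 0 0]
      unfolding D_def is_smith_normal_form_of_iff by (cases i) auto
    ultimately have "is_smith_normal_form_of D A"
      using Suc.prems nc unfolding is_smith_normal_form_of_iff by auto
    then show ?thesis by blast
  qed
qed

section \<open>Left kernels modulo q\<close>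

text \<open>The value 0 past the diagonal fits the count below: \<open>gcd 0 q = q\<close> is the
  number of choices for an unconstrained coordinate.\<close>

definition diag_entry :: "int mat \<Rightarrow> nat \<Rightarrow> int" where
  "diag_entry D i = (if i < dim_row D \<and> i < dim_col D then D $$ (i,i) else 0)"

definition left_kernel :: "int mat \<Rightarrow> int \<Rightarrow> int vec set" where
  "left_kernel A q = {u \<in> residue_vecs q (dim_row A). \<forall>j < dim_col A. q dvd u \<bullet> col A j}"

section \<open>Counting kernels of diagonal matrices\<close>

lemma residue_vecs_iff:
  "u \<in> residue_vecs q k \<longleftrightarrow> u \<in> carrier_vec k \<and> (\<forall>i<k. u $ i \<in> {0..<q})"
  by (auto simp: residue_vecs_def residue_ring_def)

text \<open>Turns coordinatewise conditions on words into a product of sets, so that cardinalities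
  multiply.\<close>

lemma bij_betw_residue_vecs:
  "bij_betw (vec k) (PiE {..<k} (\<lambda>i. {x \<in> {0..<q}. R i x}))
     {u \<in> residue_vecs q k. \<forall>i<k. R i (u $ i)}"
proof (rule bij_betwI[where g = "\<lambda>u. restrict (vec_index u) {..<k}"])
  show "vec k \<in> (PiE {..<k} (\<lambda>i. {x \<in> {0..<q}. R i x})) \<rightarrow>
      {u \<in> residue_vecs q k. \<forall>i<k. R i (u $ i)}"
    by (force simp: residue_vecs_iff)
  show "(\<lambda>u. restrict (vec_index u) {..<k}) \<in> {u \<in> residue_vecs q k. \<forall>i<k. R i (u $ i)} \<rightarrow>
      (PiE {..<k} (\<lambda>i. {x \<in> {0..<q}. R i x}))"
    by (auto simp: residue_vecs_iff)
  fix f assume "f \<in> (PiE {..<k} (\<lambda>i. {x \<in> {0..<q}. R i x}))"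
  then show "restrict (vec_index (vec k f)) {..<k} = f"
    by (auto simp: fun_eq_iff PiE_def extensional_def restrict_def)
next
  fix u assume "u \<in> {u \<in> residue_vecs q k. \<forall>i<k. R i (u $ i)}"
  then show "vec k (restrict (vec_index u) {..<k}) = u"
    by (intro eq_vecI) (auto simp: residue_vecs_iff)
qed

lemma finite_residue_vecs: "finite (residue_vecs q k)"
  using bij_betw_finite[OF bij_betw_residue_vecs[of k q "\<lambda>_ _. True"]]
  by (simp add: finite_PiE)

lemma finite_left_kernel: "finite (left_kernel A q)"
  by (rule finite_subset[OF _ finite_residue_vecs[of q "dim_row A"]]) (auto simp: left_kernel_def)

text \<open>After dividing \<open>d\<close> and \<open>q\<close> by their gcd \<open>g\<close>, the
  condition becomes \<open>q' dvd x\<close> with \<open>q = g * q'\<close>; its solutions are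
  \<open>t * q'\<close> with \<open>0 \<le> t < g\<close>.\<close>

lemma card_residue_annihilator:
  fixes q d :: int
  assumes q: "q > 0"
  shows "int (card {x \<in> {0..<q}. q dvd x * d}) = gcd d q"
proof -
  define g where "g = gcd d q"
  have g: "g > 0" using q by (simp add: g_def)
  obtain d' q' where d': "d = g * d'" and q': "q = g * q'" and cop: "coprime d' q'"
  proof
    show "d = g * (d div g)" "q = g * (q div g)" by (simp_all add: g_def)
    show "coprime (d div g) (q div g)" unfolding g_def using q by (intro div_gcd_coprime) auto
  qed
  have q'0: "q' > 0" using q g q' by (simp add: zero_less_mult_iff)
  have dvd: "q dvd x * d \<longleftrightarrow> q' dvd x" for x
  proof -
    have "q dvd x * d \<longleftrightarrow> g * q' dvd g * (x * d')" by (simp add: d' q' ac_simps)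
    also have "\<dots> \<longleftrightarrow> q' dvd x * d'" using g by simp
    also have "\<dots> \<longleftrightarrow> q' dvd x"
      using cop by (simp add: coprime_dvd_mult_left_iff coprime_commute)
    finally show ?thesis .
  qed
  have set_eq: "{x \<in> {0..<q}. q dvd x * d} = {x. 0 \<le> x \<and> x < g * q' \<and> q' dvd x}"
    unfolding dvd unfolding q' by auto
  have "bij_betw (\<lambda>t. t * q') {0..<g} {x \<in> {0..<q}. q dvd x * d}"
    unfolding set_eq
  proof (rule bij_betwI[where g = "\<lambda>x. x div q'"])
    show "(\<lambda>x. x div q') \<in> {x. 0 \<le> x \<and> x < g * q' \<and> q' dvd x} \<rightarrow> {0..<g}"
      using q'0 by (auto simp: zero_le_mult_iff elim!: dvdE)
  qed (use q'0 in auto)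
  then have "card {x \<in> {0..<q}. q dvd x * d} = nat g" by (simp add: bij_betw_same_card[symmetric])
  then show ?thesis using g by (simp add: g_def)
qed

lemma diagonal_mat_scalar_prod_col:
  assumes D: "D \<in> carrier_mat k l" "diagonal_mat D" and u: "u \<in> carrier_vec k" and j: "j < l"
  shows "u \<bullet> col D j = (if j < k then u $ j * D $$ (j,j) else 0)"
proof -
  have "u \<bullet> col D j = (\<Sum>i<k. u $ i * D $$ (i,j))"
    using D u j by (auto simp: scalar_prod_def lessThan_atLeast0)
  also have "\<dots> = (\<Sum>i<k. if i = j then u $ j * D $$ (j,j) else 0)"
    using D j by (intro sum.cong) (auto simp: diagonal_mat_def)
  finally show ?thesis by simp
qed

text \<open>The kernel conditions decouple: each coordinate is constrained by its own diagonal entry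
  only.\<close>

lemma card_left_kernel_diagonal:
  assumes D: "D \<in> carrier_mat k l" "diagonal_mat D" and q: "q > 0"
  shows "int (card (left_kernel D q)) = (\<Prod>i<k. gcd (diag_entry D i) q)"
proof -
  have "left_kernel D q = {u \<in> residue_vecs q k. \<forall>i<k. q dvd u $ i * diag_entry D i}"
    using D by (auto simp: left_kernel_def residue_vecs_iff diag_entry_def diagonal_mat_scalar_prod_col)
  then have "card (left_kernel D q) = card (PiE {..<k} (\<lambda>i. {x \<in> {0..<q}. q dvd x * diag_entry D i}))"
    using bij_betw_same_card[OF bij_betw_residue_vecs[of k q "\<lambda>i x. q dvd x * diag_entry D i"]] by simp
  then show ?thesis
    by (simp only: card_PiE[OF finite_lessThan] of_nat_prod card_residue_annihilator[OF q])
qed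

section \<open>Invariance of the kernel size under unimodular equivalence\<close>

text \<open>Words are integer representatives in \<open>{0..<q}\<close>, so an image must be reduced
  before it is a word again; such a reduction is invisible to later products modulo
  \<open>q\<close>.\<close>

lemma mult_mat_vec_mod:
  assumes M: "M \<in> carrier_mat n k" and u: "u \<in> carrier_vec k" and i: "i < n"
  shows "(M *\<^sub>v map_vec (\<lambda>x. x mod q) u) $ i mod q = (M *\<^sub>v u) $ i mod (q :: int)"
proof -
  have "(M *\<^sub>v map_vec (\<lambda>x. x mod q) u) $ i mod q = (\<Sum>j<k. M $$ (i,j) * (u $ j mod q)) mod q"
    using M u i by (auto simp: scalar_prod_def lessThan_atLeast0)
  also have "\<dots> = (\<Sum>j<k. M $$ (i,j) * u $ j) mod q"
    by (subst (1 2) mod_sum_eq[symmetric]) (simp add: mod_mult_right_eq)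
  also have "\<dots> = (M *\<^sub>v u) $ i mod q"
    using M u i by (auto simp: scalar_prod_def lessThan_atLeast0)
  finally show ?thesis .
qed

lemma dvd_mult_mat_vec:
  fixes x :: "'a :: comm_semiring_1"
  assumes "M \<in> carrier_mat n k" "w \<in> carrier_vec k" "\<forall>j<k. x dvd w $ j" "i < n"
  shows "x dvd (M *\<^sub>v w) $ i"
  using assms by (auto simp: scalar_prod_def intro!: dvd_sum dvd_mult)

lemma left_kernel_iff:
  assumes "A \<in> carrier_mat nr nc"
  shows "u \<in> left_kernel A q \<longleftrightarrow> u \<in> residue_vecs q nr \<and> (\<forall>j<nc. q dvd (A\<^sup>T *\<^sub>v u) $ j)"
proof -
  have "u \<bullet> col A j = (A\<^sup>T *\<^sub>v u) $ j" if "u \<in> carrier_vec nr" "j < nc" for j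
    using assms that by (auto intro!: comm_scalar_prod[of _ nr])
  then show ?thesis using assms by (auto simp: left_kernel_def residue_vecs_iff)
qed

text \<open>If \<open>B = P A Q\<close>, then \<open>u \<mapsto> u P\<^sup>-\<^sup>1\<close> maps the left kernel of \<open>A\<close> into that of \<open>B\<close>.\<close>

lemma card_left_kernel_le:
  assumes AB: "unimod_equiv A B" and q: "q > 0"
  shows "card (left_kernel A q) \<le> card (left_kernel B q)"
proof -
  define nr nc where "nr = dim_row A" and "nc = dim_col A"
  have A: "A \<in> carrier_mat nr nc" by (simp add: nr_def nc_def)
  have B: "B \<in> carrier_mat nr nc" using unimod_equiv_carrier[OF AB A] .
  obtain P P' Q Q' where P: "P \<in> carrier_mat nr nr" and P': "P' \<in> carrier_mat nr nr"
    and PP': "P * P' = 1\<^sub>m nr" and P'P: "P' * P = 1\<^sub>m nr" and Q: "Q \<in> carrier_mat nc nc"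
    and BPQ: "B = P * A * Q"
    using unimod_equivE[OF AB A] by blast
  \<comment> \<open>\<open>P'\<close> inverts \<open>P\<close>; transposes express row vectors times
    matrices as matrix-vector products.\<close>
  define f where "f u = map_vec (\<lambda>x. x mod q) (P'\<^sup>T *\<^sub>v u)" for u
  have PT: "P\<^sup>T \<in> carrier_mat nr nr" "P'\<^sup>T \<in> carrier_mat nr nr" using P P' by auto
  have inv: "P\<^sup>T *\<^sub>v (P'\<^sup>T *\<^sub>v u) = u" if "u \<in> carrier_vec nr" for u
  proof -
    have "P\<^sup>T *\<^sub>v (P'\<^sup>T *\<^sub>v u) = (P' * P)\<^sup>T *\<^sub>v u"
      by (simp only: transpose_mult[OF P' P] assoc_mult_mat_vec[OF PT that])
    then show ?thesis using that by (simp add: P'P)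
  qed
  have fc: "f u \<in> carrier_vec nr" for u using P' by (intro carrier_vecI) (simp add: f_def)
  \<comment> \<open>\<open>u\<close> is already reduced, so transforming back and reducing returns
    it exactly; hence \<open>f\<close> is injective.\<close>
  have undo: "(P\<^sup>T *\<^sub>v f u) $ i mod q = u $ i" if u: "u \<in> residue_vecs q nr" and i: "i < nr" for u i
  proof -
    have "(P\<^sup>T *\<^sub>v f u) $ i mod q = (P\<^sup>T *\<^sub>v (P'\<^sup>T *\<^sub>v u)) $ i mod q"
      unfolding f_def using PT u i by (intro mult_mat_vec_mod) (auto simp: residue_vecs_iff)
    also have "\<dots> = u $ i" using u i inv[of u] by (simp add: residue_vecs_iff)
    finally show ?thesis .
  qed
  have "inj_on f (left_kernel A q)"
  proof (rule inj_onI)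
    fix u v assume uv: "u \<in> left_kernel A q" "v \<in> left_kernel A q" and eq: "f u = f v"
    have res: "u \<in> residue_vecs q nr" "v \<in> residue_vecs q nr"
      using uv left_kernel_iff[OF A] by auto
    show "u = v"
    proof (rule eq_vecI)
      fix i assume "i < dim_vec v"
      then have "i < nr" using res by (auto simp: residue_vecs_iff)
      then show "u $ i = v $ i" using undo[OF res(1)] undo[OF res(2)] eq by metis
    qed (use res in \<open>auto simp: residue_vecs_iff\<close>)
  qed
  moreover have "f u \<in> left_kernel B q" if u: "u \<in> left_kernel A q" for u
  proof -
    have res: "u \<in> residue_vecs q nr" and ker: "\<forall>j<nc. q dvd (A\<^sup>T *\<^sub>v u) $ j"
      using u left_kernel_iff[OF A] by auto
    have uc: "u \<in> carrier_vec nr" using res by (simp add: residue_vecs_iff)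
    have AT: "A\<^sup>T \<in> carrier_mat nc nr" "B\<^sup>T \<in> carrier_mat nc nr" "Q\<^sup>T \<in> carrier_mat nc nc" using A B Q by auto
    have BT: "B\<^sup>T = Q\<^sup>T * (A\<^sup>T * P\<^sup>T)"
      unfolding BPQ transpose_mult[OF mult_carrier_mat[OF P A] Q] transpose_mult[OF P A] ..
    have P'u: "P'\<^sup>T *\<^sub>v u \<in> carrier_vec nr" using PT uc by simp
    \<comment> \<open>The rightmost factor \<open>P\<^sup>T\<close> of \<open>B\<^sup>T\<close>
      cancels \<open>P'\<^sup>T\<close>, leaving integral combinations of the entries of
      \<open>A\<^sup>T *\<^sub>v u\<close>, all divisible by \<open>q\<close>.\<close>
    have "B\<^sup>T *\<^sub>v (P'\<^sup>T *\<^sub>v u) = Q\<^sup>T *\<^sub>v (A\<^sup>T *\<^sub>v u)"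
      unfolding BT assoc_mult_mat_vec[OF AT(3) mult_carrier_mat[OF AT(1) PT(1)] P'u]
        assoc_mult_mat_vec[OF AT(1) PT(1) P'u] inv[OF uc] ..
    moreover have "q dvd (Q\<^sup>T *\<^sub>v (A\<^sup>T *\<^sub>v u)) $ j" if "j < nc" for j
      using dvd_mult_mat_vec[OF AT(3) mult_mat_vec_carrier[OF AT(1) uc] ker that] .
    ultimately have "\<forall>j<nc. q dvd (B\<^sup>T *\<^sub>v f u) $ j"
      using mult_mat_vec_mod[OF AT(2) P'u] by (simp add: f_def dvd_eq_mod_eq_0)
    moreover have "f u \<in> residue_vecs q nr"
      using fc[of u] q P' by (auto simp: residue_vecs_iff f_def)
    ultimately show ?thesis using left_kernel_iff[OF B] by blast
  qed
  ultimately show ?thesis by (intro card_inj_on_le[of f] finite_left_kernel) auto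
qed

section \<open>The Smith diagonal and the kernel size\<close>

text \<open>Numbered from 0 and continued by 0: below the rank, \<open>smith_diag A i\<close> is the
  elementary divisor with number \<open>i + 1\<close>.\<close>

definition smith_diag :: "int mat \<Rightarrow> nat \<Rightarrow> int" where
  "smith_diag A = diag_entry (smith_normal_form A)"

lemma smith_normal_form:
  "unimod_equiv A (smith_normal_form A)" "diagonal_mat (smith_normal_form A)"
  "smith_normal_form A \<in> carrier_mat (dim_row A) (dim_col A)"
  "i < dim_row A \<Longrightarrow> i < dim_col A \<Longrightarrow> smith_normal_form A $$ (i,i) \<ge> 0"
  "Suc i < dim_row A \<Longrightarrow> Suc i < dim_col A \<Longrightarrow>
    smith_normal_form A $$ (i,i) dvd smith_normal_form A $$ (Suc i, Suc i)"
proof -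
  have "A \<in> carrier_mat (dim_row A) (dim_col A)" by simp
  then have "is_smith_normal_form_of (smith_normal_form A) A"
    unfolding smith_normal_form_def by (rule someI_ex[OF smith_normal_form_exists])
  then show "unimod_equiv A (smith_normal_form A)" "diagonal_mat (smith_normal_form A)"
    "i < dim_row A \<Longrightarrow> i < dim_col A \<Longrightarrow> smith_normal_form A $$ (i,i) \<ge> 0"
    "Suc i < dim_row A \<Longrightarrow> Suc i < dim_col A \<Longrightarrow>
      smith_normal_form A $$ (i,i) dvd smith_normal_form A $$ (Suc i, Suc i)"
    "smith_normal_form A \<in> carrier_mat (dim_row A) (dim_col A)"
    using unimod_equiv_carrier[of A "smith_normal_form A"] by (auto simp: is_smith_normal_form_of_iff)
qed

lemma smith_diag_eq:
  "smith_diag A i = (if i < dim_row A \<and> i < dim_col A then smith_normal_form A $$ (i,i) else 0)"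
  using smith_normal_form(3)[of A] by (auto simp: smith_diag_def diag_entry_def)

lemma smith_diag_nonneg: "smith_diag A i \<ge> 0"
  using smith_normal_form(4) by (simp add: smith_diag_eq)

lemma smith_diag_dvd: "i \<le> j \<Longrightarrow> smith_diag A i dvd smith_diag A j"
  by (induction rule: dec_induct) (auto simp: smith_diag_eq smith_normal_form(5) intro: dvd_trans)

text \<open>The inequality for equivalent matrices holds in both directions, which reduces the count
  to the diagonal case.\<close>

lemma card_left_kernel:
  assumes "q > 0"
  shows "int (card (left_kernel A q)) = (\<Prod>i<dim_row A. gcd (smith_diag A i) q)"
proof -
  have "card (left_kernel A q) = card (left_kernel (smith_normal_form A) q)"
    using card_left_kernel_le[OF smith_normal_form(1)[of A] assms]
      card_left_kernel_le[OF unimod_equiv_sym[OF smith_normal_form(1)[of A]] assms] by simp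
  then show ?thesis
    using card_left_kernel_diagonal[OF smith_normal_form(3,2) assms] by (simp add: smith_diag_def)
qed

text \<open>By the divisibility chain it divides every entry of the normal form, and the equivalence
  carries this back to \<open>A\<close>.\<close>

lemma smith_diag_0_dvd:
  assumes "i < dim_row A" "j < dim_col A"
  shows "smith_diag A 0 dvd A $$ (i,j)"
proof (rule unimod_equiv_dvd[OF unimod_equiv_sym[OF smith_normal_form(1)] smith_normal_form(3) _ assms], intro allI impI)
  fix i j assume ij: "i < dim_row A" "j < dim_col A"
  show "smith_diag A 0 dvd smith_normal_form A $$ (i,j)"
  proof (cases "i = j")
    case True
    then show ?thesis using smith_diag_dvd[of 0 i A] ij by (simp add: smith_diag_eq)
  next
    case False
    then show ?thesis using smith_normal_form(2,3)[of A] ij by (auto simp: diagonal_mat_def)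
  qed
qed

section \<open>Rank and elementary divisors\<close>

text \<open>The left inverse sends the columns to distinct unit vectors. Linear independence
  concerns the set of columns, so repetitions have to be excluded separately.\<close>

lemma distinct_cols_left_inverse:
  fixes P :: "'a :: comm_ring_1 mat"
  assumes P: "P \<in> carrier_mat n k" and P': "P' \<in> carrier_mat k n" and inv: "P' * P = 1\<^sub>m k"
  shows "distinct (cols P)"
proof -
  have "col P i \<noteq> col P j" if "i < k" "j < k" "i \<noteq> j" for i j
  proof
    assume eq: "col P i = col P j"
    have "unit_vec k i = P' *\<^sub>v col P i" "unit_vec k j = P' *\<^sub>v col P j"
      using that col_mult2[OF P' P] by (auto simp: inv)
    then have "unit_vec k i $ i = (unit_vec k j $ i :: 'a)" by (simp add: eq)
    then show False using that by simp
  qed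
  then show ?thesis using P by (auto simp: distinct_conv_nth)
qed

text \<open>\<open>P\<close> has non-zero determinant, so its columns, and any subset of them, are
  independent.\<close>

lemma rank_cols_take:
  fixes P :: "'a :: field mat"
  assumes P: "P \<in> carrier_mat k k" and P': "P' \<in> carrier_mat k k" and inv: "P' * P = 1\<^sub>m k" and s: "s \<le> k"
  shows "vec_space.rank k (mat_of_cols k (take s (cols P))) = s"
proof -
  interpret vec_space "TYPE('a)" k .
  have dist: "distinct (cols P)" by (rule distinct_cols_left_inverse[OF P P' inv])
  have "det P' * det P = 1" using det_mult[OF P' P] by (simp add: inv)
  then have "det P \<noteq> 0" by fastforce
  then have "rank P = k" by (rule low_rank_det_zero[OF P])
  then have "lin_indpt (set (cols P))" using full_rank_lin_indpt[OF P _ dist] by blast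
  then have ind: "lin_indpt (set (take s (cols P)))" by (rule subset_li_is_li[OF _ set_take_subset])
  have "set (take s (cols P)) \<subseteq> carrier_vec k"
    by (rule order_trans[OF set_take_subset]) (use cols_dim[of P] P in simp)
  then have cols: "cols (mat_of_cols k (take s (cols P))) = take s (cols P)" by (rule cols_mat_of_cols)
  show ?thesis
    by (rule lin_indpt_full_rank) (use cols dist ind P s in \<open>auto intro!: carrier_matI\<close>)
qed

lemma mat_of_cols_take_mult_vec:
  fixes P :: "'a :: comm_ring_1 mat"
  assumes P: "P \<in> carrier_mat n k" and s: "s \<le> k" and w: "w \<in> carrier_vec k" and z: "\<forall>i<k. s \<le> i \<longrightarrow> w $ i = 0"
  shows "mat_of_cols n (take s (cols P)) *\<^sub>v vec s (vec_index w) = P *\<^sub>v w"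
proof (rule eq_vecI)
  fix i assume "i < dim_vec (P *\<^sub>v w)"
  then have i: "i < n" using P by simp
  have "(P *\<^sub>v w) $ i = (\<Sum>j<k. P $$ (i,j) * w $ j)"
    using P w i by (auto simp: scalar_prod_def lessThan_atLeast0)
  also have "\<dots> = (\<Sum>j<s. P $$ (i,j) * w $ j)"
    using s z by (intro sum.mono_neutral_right) auto
  also have "\<dots> = (mat_of_cols n (take s (cols P)) *\<^sub>v vec s (vec_index w)) $ i"
    using P s i by (auto simp: scalar_prod_def lessThan_atLeast0 mat_of_cols_index intro!: sum.cong)
  finally show "(mat_of_cols n (take s (cols P)) *\<^sub>v vec s (vec_index w)) $ i = (P *\<^sub>v w) $ i" ..
qed (use P in auto)

text \<open>The relations \<open>A = P * D * Q\<close> and \<open>A * Q' = P * D\<close> give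
  \<open>A\<close> and \<open>P * D\<close> the same column space. Non-zero diagonal entries are
  units in a field, so this space is spanned by the first \<open>s\<close> columns of
  \<open>P\<close>.\<close>

lemma rank_diagonal_equiv:
  fixes A :: "'a :: field mat"
  assumes A: "A \<in> carrier_mat k l" and D: "D \<in> carrier_mat k l"
    and P: "P \<in> carrier_mat k k" and P': "P' \<in> carrier_mat k k" and inv: "P' * P = 1\<^sub>m k"
    and Q: "Q \<in> carrier_mat l l" and Q': "Q' \<in> carrier_mat l l"
    and APQ: "A = P * D * Q" and AQ': "A * Q' = P * D"
    and s: "s \<le> k" "s \<le> l"
    and diag: "diagonal_mat D" "\<And>i. i < k \<Longrightarrow> i < l \<Longrightarrow> D $$ (i,i) \<noteq> 0 \<longleftrightarrow> i < s"
  shows "vec_space.rank k A = s"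
proof -
  interpret vec_space "TYPE('a)" k .
  define M where "M = mat_of_cols k (take s (cols P))"
  have M: "M \<in> carrier_mat k s" using P s by (auto simp: M_def intro!: carrier_matI)
  have Dv: "(D *\<^sub>v y) $ i = (if i < s then D $$ (i,i) * y $ i else 0)"
    if y: "y \<in> carrier_vec l" and i: "i < k" for y i
  proof -
    have "(D *\<^sub>v y) $ i = (\<Sum>j<l. D $$ (i,j) * y $ j)"
      using D y i by (auto simp: scalar_prod_def lessThan_atLeast0)
    also have "\<dots> = (\<Sum>j<l. if j = i then D $$ (i,i) * y $ i else 0)"
      using D diag(1) i by (intro sum.cong) (auto simp: diagonal_mat_def)
    finally show ?thesis using diag(2)[of i] i s by auto
  qed
  have PD: "P * D \<in> carrier_mat k l" using P D by auto
  have PDv: "(P * D) *\<^sub>v y = M *\<^sub>v vec s (vec_index (D *\<^sub>v y))" if y: "y \<in> carrier_vec l" for y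
  proof -
    have "D *\<^sub>v y \<in> carrier_vec k" using D y by simp
    moreover have "\<forall>i<k. s \<le> i \<longrightarrow> (D *\<^sub>v y) $ i = 0" using Dv[OF y] by auto
    ultimately show ?thesis
      unfolding M_def assoc_mult_mat_vec[OF P D y] using mat_of_cols_take_mult_vec[OF P s(1)] by auto
  qed
  have "col_space A = col_space M"
    unfolding col_space_eq[OF A] col_space_eq[OF M] carrier_matD[OF A] carrier_matD[OF M]
  proof (intro equalityI subsetI; elim CollectE conjE bexE; intro CollectI conjI, assumption)
    fix v x assume x: "x \<in> carrier_vec l" "A *\<^sub>v x = v"
    have "v = (P * D) *\<^sub>v (Q *\<^sub>v x)"
      unfolding x(2)[symmetric] APQ by (rule assoc_mult_mat_vec[OF PD Q x(1)])
    then have "M *\<^sub>v vec s (vec_index (D *\<^sub>v (Q *\<^sub>v x))) = v" using PDv Q x(1) by simp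
    then show "\<exists>x\<in>carrier_vec s. M *\<^sub>v x = v" by (metis vec_carrier)
  next
    fix v w assume w: "w \<in> carrier_vec s" "M *\<^sub>v w = v"
    \<comment> \<open>Dividing by the diagonal entries gives a preimage under \<open>D\<close> of
      \<open>w\<close> padded with zeros.\<close>
    define y where "y = vec l (\<lambda>i. if i < s then w $ i / D $$ (i,i) else 0)"
    have y: "y \<in> carrier_vec l" by (simp add: y_def)
    have "vec s (vec_index (D *\<^sub>v y)) = w"
      using w s Dv[OF y] diag(2) by (intro eq_vecI) (auto simp: y_def)
    then have "v = (A * Q') *\<^sub>v y" using PDv[OF y] w AQ' by simp
    also have "\<dots> = A *\<^sub>v (Q' *\<^sub>v y)" by (rule assoc_mult_mat_vec[OF A Q' y])
    finally show "\<exists>x\<in>carrier_vec l. A *\<^sub>v x = v" using mult_mat_vec_carrier[OF Q' y] by auto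
  qed
  then have "rank A = rank M" by (simp add: rank_def col_space_def)
  then show ?thesis using rank_cols_take[OF P P' inv s(1)] by (simp add: M_def)
qed

text \<open>By the divisibility chain the non-zero entries form an initial segment, of length
  \<open>s\<close>. Unimodular matrices stay invertible over the rationals, so \<open>s\<close> is
  the rank.\<close>

lemma smith_diag_nonzero_iff: "smith_diag A i \<noteq> 0 \<longleftrightarrow> i < int_mat_rank A"
proof -
  define k l where "k = dim_row A" and "l = dim_col A"
  define D where "D = smith_normal_form A"
  define s where "s = (LEAST i. smith_diag A i = 0)"
  have A: "A \<in> carrier_mat k l" by (simp add: k_def l_def)
  have D: "D \<in> carrier_mat k l" "diagonal_mat D" "unimod_equiv D A"
    using smith_normal_form(2,3)[of A] unimod_equiv_sym[OF smith_normal_form(1)[of A]]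
    by (auto simp: D_def k_def l_def)
  have "smith_diag A k = 0" "smith_diag A l = 0" by (auto simp: smith_diag_eq k_def l_def)
  then have s: "s \<le> k" "s \<le> l" unfolding s_def by (auto intro: Least_le)
  have "smith_diag A s = 0"
    unfolding s_def using \<open>smith_diag A k = 0\<close> by (rule LeastI)
  then have "smith_diag A i = 0" if "s \<le> i" for i using smith_diag_dvd[OF that, of A] by simp
  moreover have "smith_diag A i \<noteq> 0" if "i < s" for i using not_less_Least that unfolding s_def by blast
  ultimately have s_iff: "smith_diag A i \<noteq> 0 \<longleftrightarrow> i < s" for i by (metis not_le)
  obtain P P' Q Q' where PQ: "P \<in> carrier_mat k k" "P' \<in> carrier_mat k k" "P * P' = 1\<^sub>m k" "P' * P = 1\<^sub>m k"
    "Q \<in> carrier_mat l l" "Q' \<in> carrier_mat l l" "Q * Q' = 1\<^sub>m l" "Q' * Q = 1\<^sub>m l" "A = P * D * Q"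
    using unimod_equivE[OF D(3,1)] by blast
  have AQ': "A * Q' = P * D"
    unfolding PQ(9) assoc_mult_mat[OF mult_carrier_mat[OF PQ(1) D(1)] PQ(5,6)] PQ(7)
    by (rule right_mult_one_mat[OF mult_carrier_mat[OF PQ(1) D(1)]])
  let ?h = "map_mat rat_of_int"
  note hom = of_int_hom.mat_hom_mult[where 'a = rat]
  have "vec_space.rank k (?h A) = s"
  proof (rule rank_diagonal_equiv[of "?h A" k l "?h D" "?h P" "?h P'" "?h Q" "?h Q'"])
    show "?h P' * ?h P = 1\<^sub>m k"
      unfolding hom[OF PQ(2,1), symmetric] PQ(4) by (rule of_int_hom.mat_hom_one)
    show "?h A = ?h P * ?h D * ?h Q"
      unfolding hom[OF PQ(1) D(1), symmetric] hom[OF mult_carrier_mat[OF PQ(1) D(1)] PQ(5), symmetric]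
      by (simp only: PQ(9))
    show "?h A * ?h Q' = ?h P * ?h D"
      unfolding hom[OF PQ(1) D(1), symmetric] hom[OF A PQ(6), symmetric] AQ' ..
    show "diagonal_mat (?h D)" using D by (auto simp: diagonal_mat_def)
    show "?h D $$ (i,i) \<noteq> 0 \<longleftrightarrow> i < s" if "i < k" "i < l" for i
      using that D(1) s_iff[of i] by (simp add: smith_diag_eq D_def[symmetric] k_def l_def)
  qed (use A D PQ s in auto)
  then show ?thesis using s_iff by (simp add: int_mat_rank_def k_def)
qed

lemma int_mat_rank_le: "int_mat_rank A \<le> dim_row A" "int_mat_rank A \<le> dim_col A"
  using smith_diag_nonzero_iff[of A "dim_row A"] smith_diag_nonzero_iff[of A "dim_col A"]
  by (auto simp: smith_diag_eq)

lemma elementary_divisors_eq: "elementary_divisors A = map (smith_diag A) [0..<int_mat_rank A]"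
proof -
  define r N where "r = int_mat_rank A" and "N = min (dim_row A) (dim_col A)"
  have r: "r \<le> N" using int_mat_rank_le[of A] by (simp add: r_def N_def)
  have "elementary_divisors A = filter (\<lambda>d. d \<noteq> 0) (map (smith_diag A) [0..<N])"
    unfolding elementary_divisors_def N_def
    by (intro arg_cong[where f = "filter _"] map_cong) (auto simp: smith_diag_eq)
  also have "[0..<N] = [0..<r] @ [r..<N]" using upt_add_eq_append[of 0 r "N - r"] r by simp
  finally show ?thesis
    using smith_diag_nonzero_iff[of A]
    by (auto simp: r_def[symmetric] filter_map o_def filter_empty_conv intro!: filter_True)
qed

lemma elementary_divisor_eq:
  "1 \<le> i \<Longrightarrow> i \<le> int_mat_rank A \<Longrightarrow> elementary_divisor A i = smith_diag A (i - 1)"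
  by (simp add: elementary_divisor_def elementary_divisors_eq)

text \<open>From the rank on, the Smith diagonal is 0 and each factor equals
  \<open>q\<close>.\<close>

lemma card_left_kernel_rank:
  assumes q: "q > 0"
  shows "int (card (left_kernel A q)) =
    q ^ (dim_row A - int_mat_rank A) * (\<Prod>i<int_mat_rank A. gcd (smith_diag A i) q)"
proof -
  let ?r = "int_mat_rank A" and ?k = "dim_row A"
  have "{..<?k} = {..<?r} \<union> {?r..<?k}" using int_mat_rank_le(1)[of A] by auto
  then have "int (card (left_kernel A q)) =
      (\<Prod>i<?r. gcd (smith_diag A i) q) * (\<Prod>i\<in>{?r..<?k}. gcd (smith_diag A i) q)"
    unfolding card_left_kernel[OF q] by (simp add: prod.union_disjoint ivl_disj_int)
  also have "(\<Prod>i\<in>{?r..<?k}. gcd (smith_diag A i) q) = (\<Prod>i\<in>{?r..<?k}. q)"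
  proof (rule prod.cong[OF refl])
    fix i assume "i \<in> {?r..<?k}"
    then have "smith_diag A i = 0" using smith_diag_nonzero_iff[of A i] by simp
    then show "gcd (smith_diag A i) q = q" using q by simp
  qed
  finally show ?thesis by simp
qed

section \<open>Minimum weights\<close>

lemma dim_cols_submatrix:
  assumes "J \<subseteq> {..<dim_col G}"
  shows "dim_row (cols_submatrix G J) = dim_row G" "dim_col (cols_submatrix G J) = card J"
proof -
  have "{j. j < dim_col G \<and> j \<in> J} = J" using assms by auto
  then show "dim_row (cols_submatrix G J) = dim_row G" "dim_col (cols_submatrix G J) = card J"
    by (auto simp: cols_submatrix_def dim_submatrix)
qed

text \<open>\<open>submatrix\<close> keeps the chosen columns in increasing order, so column
  \<open>j\<close> lands at the number of smaller elements of \<open>J\<close>.\<close>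

lemma col_cols_submatrix:
  assumes J: "J \<subseteq> {..<dim_col G}" and j: "j \<in> J"
  shows "card {a \<in> J. a < j} < card J"
    and "col (cols_submatrix G J) (card {a \<in> J. a < j}) = col G j"
proof -
  have fin: "finite J" using J finite_subset by blast
  show less: "card {a \<in> J. a < j} < card J" using j by (intro psubset_card_mono[OF fin]) auto
  show "col (cols_submatrix G J) (card {a \<in> J. a < j}) = col G j"
  proof (rule eq_vecI)
    fix i assume "i < dim_vec (col G j)"
    then have i: "i < dim_row G" by simp
    show "col (cols_submatrix G J) (card {a \<in> J. a < j}) $ i = col G j $ i"
      using submatrix_index_card[of i G j UNIV J] i j J less
      by (auto simp: dim_cols_submatrix[OF J] cols_submatrix_def[symmetric])
  qed (simp add: dim_cols_submatrix[OF J])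
qed

text \<open>The position map is a bijection from \<open>J\<close> onto \<open>{..<card J}\<close>;
  conditions on all columns can thus ignore the renumbering.\<close>

lemma cols_cols_submatrix_image:
  assumes J: "J \<subseteq> {..<dim_col G}"
  shows "col (cols_submatrix G J) ` {..<card J} = col G ` J"
proof -
  have fin: "finite J" using J finite_subset by blast
  have inj: "inj_on (\<lambda>j. card {a \<in> J. a < j}) J"
    by (rule inj_onI) (metis pick_card_in_set)
  have "(\<lambda>j. card {a \<in> J. a < j}) ` J = {..<card J}"
    using col_cols_submatrix(1)[OF J] card_image[OF inj] by (intro card_subset_eq) auto
  then have "col (cols_submatrix G J) ` {..<card J} =
      (\<lambda>j. col (cols_submatrix G J) (card {a \<in> J. a < j})) ` J" by (metis image_image)
  then show ?thesis using col_cols_submatrix(2)[OF J] by simp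
qed

text \<open>Makes \<open>G\<close> itself the case where \<open>J\<close> is the full index
  set.\<close>

lemma cols_submatrix_all: "cols_submatrix G {..<dim_col G} = G"
proof (rule mat_col_eqI)
  fix j assume "j < dim_col G"
  moreover from this have "{a \<in> {..<dim_col G}. a < j} = {..<j}" by auto
  ultimately show "col (cols_submatrix G {..<dim_col G}) j = col G j"
    using col_cols_submatrix(2)[of "{..<dim_col G}" G j] by simp
qed (simp_all add: dim_cols_submatrix)

lemma left_kernel_cols_submatrix:
  assumes J: "J \<subseteq> {..<dim_col G}"
  shows "left_kernel (cols_submatrix G J) q = {u \<in> residue_vecs q (dim_row G). \<forall>j\<in>J. q dvd u \<bullet> col G j}"
proof -
  have "(\<forall>j<card J. q dvd u \<bullet> col (cols_submatrix G J) j) \<longleftrightarrow> (\<forall>j\<in>J. q dvd u \<bullet> col G j)" for u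
  proof -
    have "(\<forall>j<card J. q dvd u \<bullet> col (cols_submatrix G J) j) \<longleftrightarrow>
        (\<forall>c\<in>col (cols_submatrix G J) ` {..<card J}. q dvd u \<bullet> c)" by auto
    then show ?thesis unfolding cols_cols_submatrix_image[OF J] by auto
  qed
  then show ?thesis by (simp add: left_kernel_def dim_cols_submatrix[OF J])
qed

text \<open>For rank 0 the first Smith entry is 0, and it divides every entry of the submatrix,
  including those of column \<open>j\<close>.\<close>

lemma int_mat_rank_cols_submatrix_pos:
  assumes J: "J \<subseteq> {..<dim_col G}" and j: "j \<in> J" and nz: "col G j \<noteq> 0\<^sub>v (dim_row G)"
  shows "int_mat_rank (cols_submatrix G J) > 0"
proof (rule ccontr)
  assume "\<not> ?thesis"
  then have zero: "smith_diag (cols_submatrix G J) 0 = 0"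
    using smith_diag_nonzero_iff[of "cols_submatrix G J" 0] by simp
  let ?j = "card {a \<in> J. a < j}"
  have "col G j = 0\<^sub>v (dim_row G)"
  proof (rule eq_vecI)
    fix i assume "i < dim_vec (0\<^sub>v (dim_row G))"
    then have i: "i < dim_row G" by simp
    have "cols_submatrix G J $$ (i, ?j) = 0"
      using smith_diag_0_dvd[of i "cols_submatrix G J" ?j] zero i col_cols_submatrix(1)[OF J j]
      by (simp add: dim_cols_submatrix[OF J])
    moreover have "cols_submatrix G J $$ (i, ?j) = col (cols_submatrix G J) ?j $ i"
      using i col_cols_submatrix(1)[OF J j] by (simp add: dim_cols_submatrix[OF J])
    ultimately show "col G j $ i = 0\<^sub>v (dim_row G) $ i"
      using i col_cols_submatrix(2)[OF J j] by simp
  qed simp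
  then show False using nz by simp
qed

section \<open>The lcm period\<close>

text \<open>Each elementary divisor divides the last one, which is among the members of the
  lcm.\<close>

lemma smith_diag_dvd_lcm_period:
  assumes J: "J \<subseteq> {..<dim_col G}" and i: "i < int_mat_rank (cols_submatrix G J)"
  shows "smith_diag (cols_submatrix G J) i dvd lcm_period G"
proof -
  let ?A = "cols_submatrix G J"
  have "J \<noteq> {}" using i int_mat_rank_le(2)[of ?A] dim_cols_submatrix(2)[OF J] by auto
  then have "elementary_divisor ?A (int_mat_rank ?A) dvd lcm_period G"
    unfolding lcm_period_def using J by (intro dvd_Lcm) blast
  then show ?thesis
    using elementary_divisor_eq[of "int_mat_rank ?A" ?A] i
      smith_diag_dvd[of i "int_mat_rank ?A - 1" ?A] dvd_trans by auto
qed

text \<open>The lcm ranges over finitely many numbers. Non-zero columns make each rank positive, so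
  each member is a genuine non-zero diagonal entry and not a value outside the list.\<close>

lemma lcm_period_pos:
  assumes "\<forall>j<dim_col G. col G j \<noteq> 0\<^sub>v (dim_row G)"
  shows "lcm_period G > 0"
proof -
  let ?e = "\<lambda>J. elementary_divisor (cols_submatrix G J) (int_mat_rank (cols_submatrix G J))"
  let ?S = "{?e J | J. J \<noteq> {} \<and> J \<subseteq> {..<dim_col G}}"
  have "?S = ?e ` {J. J \<noteq> {} \<and> J \<subseteq> {..<dim_col G}}" by auto
  then have "finite ?S" by simp
  moreover have "?e J \<noteq> 0" if J: "J \<noteq> {}" "J \<subseteq> {..<dim_col G}" for J
  proof -
    have "int_mat_rank (cols_submatrix G J) > 0"
      using int_mat_rank_cols_submatrix_pos[OF J(2)] J assms by blast
    then show ?thesis by (simp add: elementary_divisor_eq Suc_le_eq smith_diag_nonzero_iff)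
  qed
  then have "0 \<notin> ?S" by force
  ultimately have "Lcm ?S \<noteq> 0" using Lcm_0_iff by blast
  moreover have "Lcm ?S \<ge> 0" by (rule Lcm_int_greater_eq_0)
  ultimately show ?thesis unfolding lcm_period_def by linarith
qed

section \<open>Comparing minimum weights through kernels\<close>

lemma zero_vec_in_code:
  assumes "q > 0" shows "0\<^sub>v (dim_col G) \<in> code G q"
proof -
  have "vec (dim_col G) (\<lambda>j. (0\<^sub>v (dim_row G) \<bullet> col G j) mod q) = 0\<^sub>v (dim_col G)" by auto
  moreover have "0\<^sub>v (dim_row G) \<in> residue_vecs q (dim_row G)" using assms by (simp add: residue_vecs_iff)
  ultimately show ?thesis unfolding code_def by force
qed

lemma finite_code: "finite (code G q)"
  unfolding code_def using finite_residue_vecs by (simp add: setcompr_eq_image)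

lemma min_weight_le:
  assumes "c \<in> code G q" "c \<noteq> 0\<^sub>v (dim_col G)"
  shows "min_weight G q \<le> enat (wt c)"
  using assms finite_code[of G q] by (auto simp: min_weight_def intro!: Min_le)

text \<open>A lightest non-zero word modulo \<open>q\<close> is matched by one modulo
  \<open>q'\<close> that is no heavier; if there is none, the right side is infinite.\<close>

lemma min_weight_mono:
  assumes q: "q > 0"
    and "\<And>c. c \<in> code G q \<Longrightarrow> c \<noteq> 0\<^sub>v (dim_col G) \<Longrightarrow>
      \<exists>c'\<in>code G q'. c' \<noteq> 0\<^sub>v (dim_col G) \<and> wt c' \<le> wt c"
  shows "min_weight G q' \<le> min_weight G q"
proof (cases "code G q = {0\<^sub>v (dim_col G)}")
  case False
  let ?W = "code G q - {0\<^sub>v (dim_col G)}"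
  have "wt ` ?W \<noteq> {}" using False zero_vec_in_code[OF q, of G] by blast
  then have "Min (wt ` ?W) \<in> wt ` ?W" using finite_code by (intro Min_in) auto
  then obtain c where c: "c \<in> ?W" "Min (wt ` ?W) = wt c" by blast
  then obtain c' where "c' \<in> code G q'" "c' \<noteq> 0\<^sub>v (dim_col G)" "wt c' \<le> wt c"
    using assms(2)[of c] by auto
  then have "min_weight G q' \<le> enat (wt c)"
    using min_weight_le[of c' G q'] order_trans[of _ "enat (wt c')" "enat (wt c)"] by simp
  then show ?thesis using False c(2) by (simp add: min_weight_def)
qed (simp add: min_weight_def)

text \<open>There is a non-zero codeword vanishing on \<open>J\<close> iff the left kernels of \<open>G\<^sub>J\<close> and \<open>G\<close> modulo
  \<open>q\<close> differ, so \<open>d\<^sub>q\<close> depends only on the family of those \<open>J\<close>.\<close>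

lemma min_weight_le_left_kernel:
  assumes q: "q > 0"
    and ker: "\<And>J. J \<subseteq> {..<dim_col G} \<Longrightarrow> left_kernel (cols_submatrix G J) q' = left_kernel G q' \<Longrightarrow>
      left_kernel (cols_submatrix G J) q = left_kernel G q"
  shows "min_weight G q' \<le> min_weight G q"
proof (rule min_weight_mono[OF q])
  fix c assume c: "c \<in> code G q" "c \<noteq> 0\<^sub>v (dim_col G)"
  then obtain u where u: "u \<in> residue_vecs q (dim_row G)"
    and cu: "c = vec (dim_col G) (\<lambda>j. (u \<bullet> col G j) mod q)" unfolding code_def by blast
  \<comment> \<open>The zero positions of \<open>c\<close>.\<close>
  define J where "J = {j. j < dim_col G \<and> q dvd u \<bullet> col G j}"
  have J: "J \<subseteq> {..<dim_col G}" by (auto simp: J_def)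
  have "u \<in> left_kernel (cols_submatrix G J) q"
    unfolding left_kernel_cols_submatrix[OF J] using u by (simp add: J_def)
  moreover have "u \<notin> left_kernel G q"
    using c(2) by (auto simp: cu left_kernel_def dvd_eq_mod_eq_0 intro!: eq_vecI)
  ultimately have "left_kernel (cols_submatrix G J) q' \<noteq> left_kernel G q'" using ker[OF J] by blast
  moreover have "left_kernel G q' \<subseteq> left_kernel (cols_submatrix G J) q'"
    using J unfolding left_kernel_cols_submatrix[OF J] by (auto simp: left_kernel_def)
  ultimately obtain v where v: "v \<in> left_kernel (cols_submatrix G J) q'" "v \<notin> left_kernel G q'" by blast
  \<comment> \<open>\<open>v\<close> yields zeros modulo \<open>q'\<close> on all of
    \<open>J\<close> but not everywhere, so its word is non-zero and supported inside the support of
    \<open>c\<close>.\<close>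
  define c' where "c' = vec (dim_col G) (\<lambda>j. (v \<bullet> col G j) mod q')"
  have vres: "v \<in> residue_vecs q' (dim_row G)" and vJ: "\<forall>j\<in>J. q' dvd v \<bullet> col G j"
    using v(1) by (auto simp: left_kernel_cols_submatrix[OF J])
  obtain j where j: "j < dim_col G" "\<not> q' dvd v \<bullet> col G j" using v(2) vres by (auto simp: left_kernel_def)
  have "c' \<in> code G q'" using vres unfolding code_def c'_def by blast
  moreover have "c' \<noteq> 0\<^sub>v (dim_col G)"
  proof
    assume "c' = 0\<^sub>v (dim_col G)"
    then have "c' $ j = 0" using j by simp
    then show False using j by (simp add: c'_def dvd_eq_mod_eq_0)
  qed
  moreover have "supp c' \<subseteq> supp c"
    using vJ by (auto simp: supp_def c'_def cu J_def dvd_eq_mod_eq_0)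
  then have "wt c' \<le> wt c" unfolding wt_def by (intro card_mono) (auto simp: supp_def)
  ultimately show "\<exists>c'\<in>code G q'. c' \<noteq> 0\<^sub>v (dim_col G) \<and> wt c' \<le> wt c" by blast
qed

section \<open>Counting criterion for equality of kernels\<close>

text \<open>Fewer columns impose fewer conditions, so the kernel of \<open>G\<close> is contained in
  the other; both are finite.\<close>

lemma left_kernel_cols_submatrix_eq_iff:
  assumes J: "J \<subseteq> {..<dim_col G}"
  shows "left_kernel (cols_submatrix G J) q = left_kernel G q \<longleftrightarrow>
    card (left_kernel (cols_submatrix G J) q) = card (left_kernel G q)"
    and "card (left_kernel G q) \<le> card (left_kernel (cols_submatrix G J) q)"
proof -
  have sub: "left_kernel G q \<subseteq> left_kernel (cols_submatrix G J) q"
    using J unfolding left_kernel_cols_submatrix[OF J] by (auto simp: left_kernel_def)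
  show "left_kernel (cols_submatrix G J) q = left_kernel G q \<longleftrightarrow>
      card (left_kernel (cols_submatrix G J) q) = card (left_kernel G q)"
    using card_subset_eq[OF finite_left_kernel sub] by auto
  show "card (left_kernel G q) \<le> card (left_kernel (cols_submatrix G J) q)"
    by (rule card_mono[OF finite_left_kernel sub])
qed

text \<open>Elementary divisors divide the lcm period, so their gcd with \<open>q\<close> sees only
  \<open>gcd q (lcm_period G)\<close>.\<close>

lemma card_left_kernel_cols_submatrix:
  assumes J: "J \<subseteq> {..<dim_col G}" and q: "q > 0"
  shows "int (card (left_kernel (cols_submatrix G J) q)) =
    q ^ (dim_row G - int_mat_rank (cols_submatrix G J)) *
    (\<Prod>i<int_mat_rank (cols_submatrix G J). gcd (smith_diag (cols_submatrix G J) i) (gcd q (lcm_period G)))"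
proof -
  let ?A = "cols_submatrix G J"
  have "gcd (smith_diag ?A i) q = gcd (smith_diag ?A i) (gcd q (lcm_period G))"
    if "i < int_mat_rank ?A" for i
  proof -
    have "gcd (smith_diag ?A i) (lcm_period G) = smith_diag ?A i"
      using smith_diag_dvd_lcm_period[OF J that] smith_diag_nonneg by (simp add: gcd_proj1_iff)
    then show ?thesis by (metis gcd.assoc gcd.commute)
  qed
  then show ?thesis
    unfolding card_left_kernel_rank[OF q] dim_cols_submatrix[OF J] by simp
qed

text \<open>Read off from kernel sizes: for a modulus \<open>q > 1\<close> coprime to the lcm
  period, such as its successor, these are pure powers of \<open>q\<close>, and the inclusion of
  kernels compares the exponents.\<close>

lemma int_mat_rank_cols_submatrix_le:
  assumes J: "J \<subseteq> {..<dim_col G}" and nz: "\<forall>j<dim_col G. col G j \<noteq> 0\<^sub>v (dim_row G)"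
  shows "int_mat_rank (cols_submatrix G J) \<le> int_mat_rank G"
proof -
  define q where "q = lcm_period G + 1"
  have q: "q > 1" using lcm_period_pos[OF nz] by (simp add: q_def)
  have cop: "gcd q (lcm_period G) = 1" by (simp add: q_def)
  have "int (card (left_kernel (cols_submatrix G I) q)) = q ^ (dim_row G - int_mat_rank (cols_submatrix G I))"
    if "I \<subseteq> {..<dim_col G}" for I
    using card_left_kernel_cols_submatrix[OF that, of q] q by (simp add: cop)
  from this[OF J] this[OF order_refl] left_kernel_cols_submatrix_eq_iff(2)[OF J, of q]
  have "q ^ (dim_row G - int_mat_rank G) \<le> q ^ (dim_row G - int_mat_rank (cols_submatrix G J))"
    by (simp add: cols_submatrix_all)
  then have "dim_row G - int_mat_rank G \<le> dim_row G - int_mat_rank (cols_submatrix G J)"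
    using q by simp
  then show ?thesis
    using int_mat_rank_le(1)[of G] int_mat_rank_le(1)[of "cols_submatrix G J"] dim_cols_submatrix(1)[OF J] by simp
qed

text \<open>The sizes are \<open>q ^ (k - s) * p\<close> and \<open>q ^ (k - r)\<close> with
  \<open>s \<le> r\<close> and \<open>p \<ge> 1\<close>. For \<open>s < r\<close> the first is
  strictly larger; for \<open>s = r\<close> they agree exactly when \<open>p = 1\<close>.\<close>

lemma left_kernel_cols_submatrix_eq_iff_rank:
  assumes J: "J \<subseteq> {..<dim_col G}" and nz: "\<forall>j<dim_col G. col G j \<noteq> 0\<^sub>v (dim_row G)"
    and q: "q > 1" and cop: "\<And>i. i < int_mat_rank G \<Longrightarrow> gcd (smith_diag G i) (gcd q (lcm_period G)) = 1"
  shows "left_kernel (cols_submatrix G J) q = left_kernel G q \<longleftrightarrow>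
    int_mat_rank (cols_submatrix G J) = int_mat_rank G \<and>
    (\<Prod>i<int_mat_rank (cols_submatrix G J). gcd (smith_diag (cols_submatrix G J) i) (gcd q (lcm_period G))) = 1"
proof -
  let ?k = "dim_row G" and ?r = "int_mat_rank G" and ?s = "int_mat_rank (cols_submatrix G J)"
  let ?p = "\<Prod>i<?s. gcd (smith_diag (cols_submatrix G J) i) (gcd q (lcm_period G))"
  have cG: "int (card (left_kernel G q)) = q ^ (?k - ?r)"
    using card_left_kernel_cols_submatrix[OF order_refl, of q G] q cop by (simp add: cols_submatrix_all)
  have cJ: "int (card (left_kernel (cols_submatrix G J) q)) = q ^ (?k - ?s) * ?p"
    by (rule card_left_kernel_cols_submatrix[OF J]) (use q in simp)
  have iff: "left_kernel (cols_submatrix G J) q = left_kernel G q \<longleftrightarrow>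
      q ^ (?k - ?s) * ?p = q ^ (?k - ?r)"
    unfolding left_kernel_cols_submatrix_eq_iff(1)[OF J] cG[symmetric] cJ[symmetric] by simp
  have p: "?p \<ge> 1"
    using q by (intro prod_ge_1) (simp add: Suc_le_eq int_one_le_iff_zero_less)
  have s: "?s \<le> ?r" by (rule int_mat_rank_cols_submatrix_le[OF J nz])
  have r: "?r \<le> ?k" by (rule int_mat_rank_le(1))
  show ?thesis
  proof (cases "?s = ?r")
    case True
    then show ?thesis unfolding iff using q by simp
  next
    case False
    then have "?k - ?r < ?k - ?s" using s r by simp
    then have "q ^ (?k - ?r) < q ^ (?k - ?s)" using q by (rule power_strict_increasing)
    also have "\<dots> \<le> q ^ (?k - ?s) * ?p"
      using mult_left_mono[OF p, of "q ^ (?k - ?s)"] q by simp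
    finally show ?thesis unfolding iff using False by simp
  qed
qed

text \<open>Both moduli satisfy the same criterion, so the same sets \<open>J\<close> have a kernel
  equal to that of \<open>G\<close>.\<close>

lemma min_weight_cong:
  assumes nz: "\<forall>j<dim_col G. col G j \<noteq> 0\<^sub>v (dim_row G)"
    and q: "q > 1" and q': "q' > 1" and eq: "gcd q (lcm_period G) = gcd q' (lcm_period G)"
    and cop: "\<And>i. i < int_mat_rank G \<Longrightarrow> gcd (smith_diag G i) (gcd q (lcm_period G)) = 1"
  shows "min_weight G q = min_weight G q'"
proof (rule order_antisym)
  have ker: "left_kernel (cols_submatrix G J) q = left_kernel G q \<longleftrightarrow>
      left_kernel (cols_submatrix G J) q' = left_kernel G q'" if J: "J \<subseteq> {..<dim_col G}" for J
    using left_kernel_cols_submatrix_eq_iff_rank[OF J nz q cop]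
      left_kernel_cols_submatrix_eq_iff_rank[OF J nz q' cop[unfolded eq]] by (simp add: eq)
  show "min_weight G q \<le> min_weight G q'" "min_weight G q' \<le> min_weight G q"
    using q q' ker by (auto intro!: min_weight_le_left_kernel)
qed

lemma code_trivial:
  assumes q: "q > 0" and dvd: "\<And>i j. i < dim_row G \<Longrightarrow> j < dim_col G \<Longrightarrow> q dvd G $$ (i,j)"
  shows "code G q = {0\<^sub>v (dim_col G)}"
proof -
  have "q dvd u \<bullet> col G j" if "j < dim_col G" for u j
    using dvd that by (auto simp: scalar_prod_def intro!: dvd_sum dvd_mult)
  then have "code G q \<subseteq> {0\<^sub>v (dim_col G)}" by (auto simp: code_def)
  then show ?thesis using zero_vec_in_code[OF q, of G] by blast
qed

text \<open>The message \<open>unit_vec\<close> selects row \<open>i\<close>, whose entry at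
  \<open>j\<close> is non-zero and too small in absolute value to be divisible by
  \<open>q\<close>.\<close>

lemma code_nontrivial:
  assumes ij: "i < dim_row G" "j < dim_col G" and nz: "G $$ (i,j) \<noteq> 0" and q: "q > \<bar>G $$ (i,j)\<bar>"
  shows "code G q \<noteq> {0\<^sub>v (dim_col G)}"
proof -
  have q1: "q > 1" using nz q by linarith
  define c where "c = vec (dim_col G) (\<lambda>j. (unit_vec (dim_row G) i \<bullet> col G j) mod q)"
  have "unit_vec (dim_row G) i \<in> residue_vecs q (dim_row G)"
    using q1 by (auto simp: residue_vecs_iff unit_vec_def)
  then have "c \<in> code G q" unfolding code_def c_def by blast
  moreover have "c $ j \<noteq> 0"
  proof -
    have "c $ j = G $$ (i,j) mod q" using ij by (simp add: c_def)
    moreover have "\<not> q dvd G $$ (i,j)" using dvd_imp_le_int[OF nz, of q] q q1 by auto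
    ultimately show ?thesis by (simp add: dvd_eq_mod_eq_0)
  qed
  ultimately show ?thesis using ij by auto
qed

section \<open>Dependence of \<open>d q\<close> on \<open>gcd q \<rho>\<^sub>0\<close>\<close>

theorem theorem1p1:
  fixes G :: "int mat" and k n r :: nat and m \<rho>\<^sub>0 :: int and d :: "int \<Rightarrow> enat"
  assumes "G \<in> carrier_mat k n" and "k \<ge> 1" and "n \<ge> 1"
    and "\<forall>j < n. col G j \<noteq> 0\<^sub>v k"
    and "\<rho>\<^sub>0 = lcm_period G"
    and "r = int_mat_rank G"
    and "m > 0" and "m dvd \<rho>\<^sub>0"
    and "\<forall>q > 0. d q = min_weight G q"
  shows "(\<forall>q > 1. gcd q \<rho>\<^sub>0 = 1 \<longrightarrow> d q = d (LEAST q. q > 1 \<and> gcd q \<rho>\<^sub>0 = 1)) \<and>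
         (m \<ge> 2 \<and> gcd m (elementary_divisor G r) = 1 \<longrightarrow>
            (\<forall>q > 0. gcd q \<rho>\<^sub>0 = m \<longrightarrow> d q = d m)) \<and>
         ((\<forall>q > 0. gcd q \<rho>\<^sub>0 = m \<longrightarrow> d q = d m) \<longrightarrow>
            \<not> m dvd elementary_divisor G 1)"
proof -
  have dim: "dim_row G = k" "dim_col G = n" using assms(1) by auto
  have nz: "\<forall>j<dim_col G. col G j \<noteq> 0\<^sub>v (dim_row G)" using assms(4) dim by simp
  have rho: "\<rho>\<^sub>0 > 0" using lcm_period_pos[OF nz] assms(5) by simp
  \<comment> \<open>Positive rank ensures that the list of elementary divisors is non-empty, so its
    members numbered 1 and \<open>r\<close> exist.\<close>
  have r: "r > 0"
    using int_mat_rank_cols_submatrix_pos[of "{..<n}" G 0] nz assms(3,6) dim cols_submatrix_all[of G] by simp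
  have d: "d q = min_weight G q" if "q > 0" for q using assms(9) that by blast
  have part1: "d q = d (LEAST q. q > 1 \<and> gcd q \<rho>\<^sub>0 = 1)" if q: "q > 1" "gcd q \<rho>\<^sub>0 = 1" for q
  proof -
    \<comment> \<open>The integers are not well-ordered, so the minimum is found among the natural
      numbers and transferred.\<close>
    let ?P = "\<lambda>n. int n > 1 \<and> gcd (int n) \<rho>\<^sub>0 = 1"
    define m0 where "m0 = int (LEAST n. ?P n)"
    have "?P (nat q)" using q by simp
    then have "?P (LEAST n. ?P n)" by (rule LeastI)
    then have m0: "m0 > 1" "gcd m0 \<rho>\<^sub>0 = 1" unfolding m0_def by blast+
    have "(LEAST q. q > 1 \<and> gcd q \<rho>\<^sub>0 = 1) = m0"
    proof (rule Least_equality)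
      fix q :: int assume q: "q > 1 \<and> gcd q \<rho>\<^sub>0 = 1"
      then have "(LEAST n. ?P n) \<le> nat q" by (intro Least_le) simp
      then show "m0 \<le> q" unfolding m0_def using q by linarith
    qed (use m0 in simp)
    \<comment> \<open>Both gcds with the period are 1, so the coprimality condition holds
      trivially.\<close>
    moreover have "min_weight G q = min_weight G m0"
      using q m0 assms(5) by (intro min_weight_cong[OF nz]) auto
    ultimately show ?thesis using d[of q] d[of m0] q m0 by simp
  qed
  have part2: "d q = d m" if m: "m \<ge> 2" "gcd m (elementary_divisor G r) = 1" and q: "q > 0" "gcd q \<rho>\<^sub>0 = m" for q
  proof -
    \<comment> \<open>Hence \<open>m\<close> itself is a modulus with the same gcd as
      \<open>q\<close>, and the two can be compared.\<close>
    have gm: "gcd m \<rho>\<^sub>0 = m" using assms(7,8) by (simp add: gcd_proj1_iff)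
    have "m dvd q" using q(2) by (metis gcd_dvd1)
    then have q1: "q > 1" using m(1) zdvd_imp_le[of m q] q(1) by linarith
    have "gcd (smith_diag G i) m = 1" if "i < int_mat_rank G" for i
    proof -
      have "smith_diag G i dvd elementary_divisor G r"
        using that r assms(6) smith_diag_dvd[of i "r - 1" G] by (simp add: elementary_divisor_eq Suc_le_eq)
      then have "coprime (smith_diag G i) m"
        using coprime_divisors[of "smith_diag G i" "elementary_divisor G r" m m] m(2)
        by (simp add: coprime_iff_gcd_eq_1 gcd.commute)
      then show ?thesis by simp
    qed
    then have "min_weight G q = min_weight G m"
      using q1 m q(2) gm assms(5) by (intro min_weight_cong[OF nz]) auto
    then show ?thesis using d q(1) assms(7) by simp
  qed
  have part3: False
    if const: "\<forall>q > 0. gcd q \<rho>\<^sub>0 = m \<longrightarrow> d q = d m" and dvd: "m dvd elementary_divisor G 1"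
  proof -
    have "m dvd smith_diag G 0" using dvd r assms(6) by (simp add: elementary_divisor_eq Suc_le_eq)
    then have "code G m = {0\<^sub>v (dim_col G)}"
      using code_trivial[OF assms(7)] smith_diag_0_dvd dvd_trans by blast
    then have dm: "d m = \<infinity>" using d assms(7) by (simp add: min_weight_def)
    have "col G 0 \<noteq> 0\<^sub>v k" using assms(3,4) by simp
    then obtain i where i: "i < k" "G $$ (i,0) \<noteq> 0"
      using dim assms(3) by (metis One_nat_def Suc_le_lessD dim_col eq_vecI index_col index_zero_vec)
    \<comment> \<open>The cofactor \<open>1 + \<rho>\<^sub>0 * g\<close> is coprime to the period,
      which keeps the gcd at \<open>m\<close>, and exceeds \<open>g\<close>, so the chosen entry
      stays non-zero modulo \<open>q\<close>.\<close>
    define g q where "g = \<bar>G $$ (i,0)\<bar>" and "q = m * (1 + \<rho>\<^sub>0 * g)"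
    have g: "g > 0" using i by (simp add: g_def)
    have q: "q > g"
    proof -
      have "g \<le> \<rho>\<^sub>0 * g" using rho g by simp
      then have pos: "g < 1 + \<rho>\<^sub>0 * g" by simp
      also have "\<dots> = 1 * (1 + \<rho>\<^sub>0 * g)" by simp
      also have "\<dots> \<le> q"
        unfolding q_def using assms(7) g pos by (intro mult_right_mono) linarith+
      finally show ?thesis .
    qed
    obtain t where t: "\<rho>\<^sub>0 = m * t" using assms(8) by blast
    \<comment> \<open>\<open>t\<close> divides \<open>\<rho>\<^sub>0 * g\<close>; cancelling the
      common factor \<open>m\<close> from \<open>q\<close> and the period leaves this gcd.\<close>
    have "gcd (1 + \<rho>\<^sub>0 * g) t = 1"
      unfolding t using gcd_add_mult[of t "m * g" 1] by (simp add: gcd.commute ac_simps)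
    then have "gcd q \<rho>\<^sub>0 = m" using gcd_mult_distrib_int[of m "1 + \<rho>\<^sub>0 * g" t] assms(7) by (simp add: q_def t)
    then have "d q = \<infinity>" using const q g dm by simp
    moreover have "d q \<noteq> \<infinity>"
      using code_nontrivial[of i G 0 q] i dim assms(3) q g d[of q] by (simp add: min_weight_def g_def)
    ultimately show False by simp
  qed
  show ?thesis
    by (intro conjI allI impI notI; (elim conjE)?; rule part1 part2 part3; assumption)
qed

end
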